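(* Let $$X_{\Gamma,\Omega}=\Big\{(x,y,z,t_2,t_4,t_6)\in\mathbb{C}^3\times\mathbb{C}^3\ \Big|\ z^2=xy(x+y)-\tfrac12t_2xy-\tfrac14t_4x+\tfrac14\big(t_6+\tfrac16t_2t_4+\tfrac1{108}t_2^3\big)\Big\},$$ let $\alpha^\Omega:X_{\Gamma,\Omega}\to(\mathfrak{h}/W)^\Omega=\mathbb{C}^3$, $(x,y,z,t_2,t_4,t_6)\mapsto(t_2,t_4,t_6)$, be the semiuniversal deformation of the simple singularity of type $C_3=(D_4,\mathbb{Z}/2\mathbb{Z})$, and let $\Omega=\mathbb{Z}/2\mathbb{Z}=\langle\sigma\rangle$ act on $X_{\Gamma,\Omega}$ by $$\sigma.(x,y,z,t_2,t_4,t_6)=\big(x,\,-x-y+\tfrac12t_2,\,-z,\,t_2,t_4,t_6\big).$$ Then every fibre of the quotient morphism $\overline{\alpha^\Omega}:X_{\Gamma,\Omega}/\Omega\to(\mathfrak{h}/W)^\Omega$, which is a deformation of a simple singularity of type $D_6$, is singular.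
   Context: The base field is $\mathbb{C}$. Here $\Gamma=\mathcal{D}_2$ and $\Gamma'=\mathcal{D}_4$ are the binary dihedral groups of orders 8 and 16 in $\mathrm{SU}_2$, $\Omega=\Gamma'/\Gamma$; $\mathfrak{h}$ is a Cartan subalgebra of type $D_4$ and $W$ its Weyl group, with $(\mathfrak{h}/W)^\Omega$ identified with $\mathbb{C}^3$ through the coordinates $(t_2,t_4,t_6)$. Since $\alpha^\Omega$ is $\Omega$-invariant, $\Omega$ acts on each fibre; $\overline{\alpha^\Omega}$ is the map induced on the quotient variety, and its fibre over $(t_2,t_4,t_6)$ is the quotient of $(\alpha^\Omega)^{-1}(t_2,t_4,t_6)$ by $\Omega$. A fibre is singular if it has at least one singular point. *)

theory Defs
  imports Complex_Main "HOL-Library.Function_Algebras" "HOL-Library.Extended_Nat"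
begin

section \<open>Affine varieties over the complex numbers\<close>

text \<open>
  An affine variety is a set of points together with its coordinate ring, realised as an algebra
  of complex-valued functions on the points. So that such functions are determined by their
  values on the points, the regular functions are normalised to vanish outside the set of points;
  the unit of the coordinate ring is thus the indicator function of the set of points. Sums and
  products of functions are the pointwise ones of \<^theory>\<open>HOL-Library.Function_Algebras\<close>.
\<close>

record 'a variety =
  points :: "'a set"
  regular :: "('a \<Rightarrow> complex) set"

inductive_set polynomial_functions :: "('a \<Rightarrow> complex) set \<Rightarrow> ('a \<Rightarrow> complex) set"
  for coords :: "('a \<Rightarrow> complex) set" where
  const: "(\<lambda>_. c) \<in> polynomial_functions coords"
| coord: "f \<in> coords \<Longrightarrow> f \<in> polynomial_functions coords"
| add: "f \<in> polynomial_functions coords \<Longrightarrow> g \<in> polynomial_functions coords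
    \<Longrightarrow> f + g \<in> polynomial_functions coords"
| mult: "f \<in> polynomial_functions coords \<Longrightarrow> g \<in> polynomial_functions coords
    \<Longrightarrow> f * g \<in> polynomial_functions coords"

definition affine_space :: "('a \<Rightarrow> complex) set \<Rightarrow> 'a variety" where
  "affine_space coords = \<lparr>points = UNIV, regular = polynomial_functions coords\<rparr>"

text \<open>Closed subsets carry the reduced structure: their regular functions are the restrictions.\<close>

definition subvariety :: "'a variety \<Rightarrow> 'a set \<Rightarrow> 'a variety" where
  "subvariety V Z =
    \<lparr>points = points V \<inter> Z,
     regular = {(\<lambda>p. if p \<in> points V \<inter> Z then f p else 0) | f. f \<in> regular V}\<rparr>"

definition pullback :: "'a variety \<Rightarrow> ('a \<Rightarrow> 'b) \<Rightarrow> ('b \<Rightarrow> complex) \<Rightarrow> 'a \<Rightarrow> complex" where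
  "pullback V \<phi> h = (\<lambda>p. if p \<in> points V then h (\<phi> p) else 0)"

definition morphism :: "'a variety \<Rightarrow> 'b variety \<Rightarrow> ('a \<Rightarrow> 'b) \<Rightarrow> bool" where
  "morphism V W \<phi> \<longleftrightarrow>
    (\<forall>p\<in>points V. \<phi> p \<in> points W) \<and> (\<forall>h\<in>regular W. pullback V \<phi> h \<in> regular V)"

definition isomorphic :: "'a variety \<Rightarrow> 'b variety \<Rightarrow> bool" where
  "isomorphic V W \<longleftrightarrow>
    (\<exists>\<phi> \<psi>. morphism V W \<phi> \<and> morphism W V \<psi> \<and>
      (\<forall>p\<in>points V. \<psi> (\<phi> p) = p) \<and> (\<forall>q\<in>points W. \<phi> (\<psi> q) = q))"

definition fibre :: "'a variety \<Rightarrow> ('a \<Rightarrow> 'b) \<Rightarrow> 'b \<Rightarrow> 'a variety" where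
  "fibre V \<phi> s = subvariety V {p. \<phi> p = s}"

text \<open>
  Quotient by a finite group of automorphisms: the points are the orbits, and the coordinate ring
  is the ring of invariant regular functions, regarded as functions on the orbits.
\<close>

definition orbit :: "('a \<Rightarrow> 'a) set \<Rightarrow> 'a \<Rightarrow> 'a set" where
  "orbit G p = (\<lambda>g. g p) ` G"

definition quotient_variety :: "'a variety \<Rightarrow> ('a \<Rightarrow> 'a) set \<Rightarrow> 'a set variety" where
  "quotient_variety V G =
    \<lparr>points = orbit G ` points V,
     regular = {F. (\<forall>q. q \<notin> orbit G ` points V \<longrightarrow> F q = 0) \<and>
                   pullback V (orbit G) F \<in> regular V}\<rparr>"

text \<open>The map on orbits induced by an invariant map.\<close>

definition induced_map :: "('a \<Rightarrow> 'b) \<Rightarrow> 'a set \<Rightarrow> 'b" where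
  "induced_map \<phi> q = the_elem (\<phi> ` q)"


section \<open>Singular points\<close>

definition zariski_closed :: "'a variety \<Rightarrow> 'a set \<Rightarrow> bool" where
  "zariski_closed V Z \<longleftrightarrow> (\<exists>S\<subseteq>regular V. Z = {p \<in> points V. \<forall>f\<in>S. f p = 0})"

definition irreducible_closed :: "'a variety \<Rightarrow> 'a set \<Rightarrow> bool" where
  "irreducible_closed V Z \<longleftrightarrow> zariski_closed V Z \<and> Z \<noteq> {} \<and>
    (\<forall>A B. zariski_closed V A \<and> zariski_closed V B \<and> Z \<subseteq> A \<union> B \<longrightarrow> Z \<subseteq> A \<or> Z \<subseteq> B)"

text \<open>
  The local dimension at a point, i.e. the Krull dimension of the local ring there: chains of
  irreducible closed subsets through the point are chains of prime ideals of the local ring.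
\<close>

definition local_dim :: "'a variety \<Rightarrow> 'a \<Rightarrow> enat" where
  "local_dim V p = Sup {enat n | n. \<exists>Z :: nat \<Rightarrow> 'a set.
     (\<forall>i\<le>n. irreducible_closed V (Z i) \<and> p \<in> Z i) \<and> (\<forall>i<n. Z i \<subset> Z (Suc i))}"

text \<open>
  The Zariski tangent space (the dual of the cotangent space of the local ring), as the space of
  complex-linear point derivations of the coordinate ring. Derivations are normalised to be zero
  on functions that are not regular.
\<close>

definition tangent_space :: "'a variety \<Rightarrow> 'a \<Rightarrow> (('a \<Rightarrow> complex) \<Rightarrow> complex) set" where
  "tangent_space V p = {D.
     (\<forall>f. f \<notin> regular V \<longrightarrow> D f = 0) \<and>
     (\<forall>c. \<forall>f\<in>regular V. D (\<lambda>q. c * f q) = c * D f) \<and>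
     (\<forall>f\<in>regular V. \<forall>g\<in>regular V. D (f + g) = D f + D g) \<and>
     (\<forall>f\<in>regular V. \<forall>g\<in>regular V. D (f * g) = f p * D g + g p * D f)}"

lemma vector_space_complex_fun:
  "vector_space (\<lambda>(c::complex) (D :: 'b \<Rightarrow> complex) f. c * D f)"
  by unfold_locales (auto simp: fun_eq_iff algebra_simps)

text \<open>Coordinate rings are finitely generated, so tangent spaces are finite-dimensional.\<close>

definition tangent_dim :: "'a variety \<Rightarrow> 'a \<Rightarrow> nat" where
  "tangent_dim V p = vector_space.dim (\<lambda>(c::complex) D f. c * D f) (tangent_space V p)"

text \<open>A point is singular if its local ring is not regular.\<close>

definition singular_point :: "'a variety \<Rightarrow> 'a \<Rightarrow> bool" where
  "singular_point V p \<longleftrightarrow> p \<in> points V \<and> enat (tangent_dim V p) \<noteq> local_dim V p"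

definition singular :: "'a variety \<Rightarrow> bool" where
  "singular V \<longleftrightarrow> (\<exists>p. singular_point V p)"


section \<open>Deformations\<close>

text \<open>
  Flatness of the coordinate ring of the source over that of the target, by the equational
  criterion: every linear relation in the module is a consequence of relations in the base ring.
\<close>

definition flat :: "'a variety \<Rightarrow> 'b variety \<Rightarrow> ('a \<Rightarrow> 'b) \<Rightarrow> bool" where
  "flat V W \<phi> \<longleftrightarrow>
    (\<forall>(n::nat) a m.
      (\<forall>i<n. a i \<in> regular W \<and> m i \<in> regular V) \<and> (\<Sum>i<n. pullback V \<phi> (a i) * m i) = 0 \<longrightarrow>
      (\<exists>(k::nat) b y.
        (\<forall>j<k. y j \<in> regular V) \<and> (\<forall>i<n. \<forall>j<k. b i j \<in> regular W) \<and>
        (\<forall>i<n. m i = (\<Sum>j<k. pullback V \<phi> (b i j) * y j)) \<and>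
        (\<forall>j<k. (\<Sum>i<n. a i * b i j) = 0)))"

text \<open>
  The scheme-theoretic fibre is reduced: every regular function vanishing on the fibre lies in the
  ideal generated by the pullbacks of the functions vanishing at the base point.
\<close>

definition reduced_fibre :: "'a variety \<Rightarrow> 'b variety \<Rightarrow> ('a \<Rightarrow> 'b) \<Rightarrow> 'b \<Rightarrow> bool" where
  "reduced_fibre V W \<phi> s \<longleftrightarrow>
    (\<forall>f\<in>regular V. (\<forall>p\<in>points (fibre V \<phi> s). f p = 0) \<longrightarrow>
      (\<exists>(n::nat) a g. (\<forall>i<n. a i \<in> regular W \<and> a i s = 0 \<and> g i \<in> regular V) \<and>
        f = (\<Sum>i<n. pullback V \<phi> (a i) * g i)))"

definition deformation_of ::
    "'a variety \<Rightarrow> 'b variety \<Rightarrow> ('a \<Rightarrow> 'b) \<Rightarrow> 'b \<Rightarrow> 'c variety \<Rightarrow> bool" where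
  "deformation_of V W \<phi> s V0 \<longleftrightarrow>
    morphism V W \<phi> \<and> s \<in> points W \<and> flat V W \<phi> \<and> reduced_fibre V W \<phi> s \<and>
    isomorphic (fibre V \<phi> s) V0"


section \<open>The family of type \<open>C\<^sub>3\<close> and its quotient\<close>

type_synonym C3 = "complex \<times> complex \<times> complex"
type_synonym C6 = "complex \<times> complex \<times> complex \<times> C3"

definition affine3 :: "C3 variety" where
  "affine3 = affine_space {\<lambda>(a, b, c). a, \<lambda>(a, b, c). b, \<lambda>(a, b, c). c}"

definition coords6 :: "(C6 \<Rightarrow> complex) set" where
  "coords6 =
    {\<lambda>(x, y, z, t2, t4, t6). x, \<lambda>(x, y, z, t2, t4, t6). y, \<lambda>(x, y, z, t2, t4, t6). z,
     \<lambda>(x, y, z, t2, t4, t6). t2, \<lambda>(x, y, z, t2, t4, t6). t4, \<lambda>(x, y, z, t2, t4, t6). t6}"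

definition affine6 :: "C6 variety" where
  "affine6 = affine_space coords6"

definition X_C3 :: "C6 variety" where
  "X_C3 = subvariety affine6 {(x, y, z, t2, t4, t6).
     z\<^sup>2 = x * y * (x + y) - 1/2 * t2 * x * y - 1/4 * t4 * x
           + 1/4 * (t6 + 1/6 * t2 * t4 + 1/108 * t2 ^ 3)}"

fun alpha :: "C6 \<Rightarrow> C3" where
  "alpha (x, y, z, t2, t4, t6) = (t2, t4, t6)"

fun sigma :: "C6 \<Rightarrow> C6" where
  "sigma (x, y, z, t2, t4, t6) = (x, - x - y + 1/2 * t2, - z, t2, t4, t6)"

definition Omega :: "(C6 \<Rightarrow> C6) set" where
  "Omega = {id, sigma}"

definition X_quot :: "C6 set variety" where
  "X_quot = quotient_variety X_C3 Omega"

definition alpha_quot :: "C6 set \<Rightarrow> C3" where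
  "alpha_quot = induced_map alpha"

text \<open>The simple surface singularity of type \<open>D\<^sub>6\<close>.\<close>

definition D6_surface :: "C3 variety" where
  "D6_surface = subvariety affine3 {(x, y, z). x ^ 5 + x * y\<^sup>2 + z\<^sup>2 = 0}"

lemma sigma_sigma [simp]: "sigma (sigma p) = p"
  by (cases p) auto

lemma alpha_sigma [simp]: "alpha (sigma p) = alpha p"
  by (cases p) auto

lemma points_X_C3_iff:
  "(x, y, z, t2, t4, t6) \<in> points X_C3 \<longleftrightarrow>
     z\<^sup>2 = x * y * (x + y) - 1/2 * t2 * x * y - 1/4 * t4 * x
           + 1/4 * (t6 + 1/6 * t2 * t4 + 1/108 * t2 ^ 3)"
  by (simp add: X_C3_def subvariety_def affine6_def affine_space_def)

lemma sigma_points_X_C3 [simp]: "sigma p \<in> points X_C3 \<longleftrightarrow> p \<in> points X_C3"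
proof -
  obtain x y z t2 t4 t6 where p: "p = (x, y, z, t2, t4, t6)" by (cases p) auto
  have "x * (- x - y + 1/2 * t2) * (x + (- x - y + 1/2 * t2)) - 1/2 * t2 * x * (- x - y + 1/2 * t2)
      = x * y * (x + y) - 1/2 * t2 * x * y"
    by (simp add: field_simps)
  then show ?thesis by (simp only: p sigma.simps points_X_C3_iff power2_minus)
qed

lemma sigma_polynomial:
  assumes "f \<in> regular affine6" shows "(\<lambda>p. f (sigma p)) \<in> regular affine6"
proof -
  let ?R = "regular affine6"
  have R: "?R = polynomial_functions coords6"
    by (simp add: affine6_def affine_space_def)
  note intros = polynomial_functions.intros[where coords = coords6, folded R]
  have x: "(\<lambda>(x, y, z, t2, t4, t6). x) \<in> ?R" and y: "(\<lambda>(x, y, z, t2, t4, t6). y) \<in> ?R"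
    and z: "(\<lambda>(x, y, z, t2, t4, t6). z) \<in> ?R" and t2: "(\<lambda>(x, y, z, t2, t4, t6). t2) \<in> ?R"
    by (rule intros(2); simp add: coords6_def)+
  have z': "(\<lambda>_. -1) * (\<lambda>(x, y, z, t2, t4, t6). z) \<in> ?R"
    by (intro intros(1,4) z)
  have y': "(\<lambda>_. -1) * (\<lambda>(x, y, z, t2, t4, t6). x) + (\<lambda>_. -1) * (\<lambda>(x, y, z, t2, t4, t6). y)
      + (\<lambda>_. 1/2) * (\<lambda>(x, y, z, t2, t4, t6). t2) \<in> ?R"
    by (intro intros(1,3,4) x y t2)
  show ?thesis using assms unfolding R
  proof induction
    case (coord f)
    then consider "f = (\<lambda>(x, y, z, t2, t4, t6). y)" | "f = (\<lambda>(x, y, z, t2, t4, t6). z)"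
      | "(\<lambda>p. f (sigma p)) = f"
      by (auto simp: fun_eq_iff coords6_def)
    then show ?case
    proof cases
      case 1
      have "(\<lambda>p. f (sigma p)) = (\<lambda>_. -1) * (\<lambda>(x, y, z, t2, t4, t6). x)
          + (\<lambda>_. -1) * (\<lambda>(x, y, z, t2, t4, t6). y)
          + (\<lambda>_. 1/2) * (\<lambda>(x, y, z, t2, t4, t6). t2)"
        using 1 by (auto simp: fun_eq_iff)
      with y' show ?thesis by (simp add: R)
    next
      case 2
      have "(\<lambda>p. f (sigma p)) = (\<lambda>_. -1) * (\<lambda>(x, y, z, t2, t4, t6). z)"
        using 2 by (auto simp: fun_eq_iff)
      with z' show ?thesis by (simp add: R)
    next
      case 3
      then show ?thesis using coord by (metis polynomial_functions.coord)
    qed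
  next
    case (const c)
    show ?case by (rule polynomial_functions.const)
  next
    case (add f g)
    then show ?case using polynomial_functions.add[OF add.IH] by (simp add: plus_fun_def)
  next
    case (mult f g)
    then show ?case using polynomial_functions.mult[OF mult.IH] by (simp add: times_fun_def)
  qed
qed

lemma orbit_Omega: "orbit Omega p = {p, sigma p}"
  by (auto simp: orbit_def Omega_def)

lemma orbit_Omega_sigma [simp]: "orbit Omega (sigma p) = orbit Omega p"
  by (auto simp: orbit_Omega)

lemma alpha_quot_orbit [simp]: "alpha_quot (orbit Omega p) = alpha p"
  by (simp add: alpha_quot_def induced_map_def orbit_Omega)

text \<open>The fibres of the quotient morphism are the quotients of the fibres.\<close>

lemma fibre_alpha_quot: "fibre X_quot alpha_quot t = quotient_variety (fibre X_C3 alpha t) Omega"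
  (is "?L = ?R")
proof -
  have pL: "points ?L = orbit Omega ` {p \<in> points X_C3. alpha p = t}"
    by (auto simp: fibre_def subvariety_def X_quot_def quotient_variety_def)
  have pF: "points (fibre X_C3 alpha t) = {p \<in> points X_C3. alpha p = t}"
    by (auto simp: fibre_def subvariety_def)
  have pR: "points ?R = points ?L"
    by (simp add: pL pF quotient_variety_def)
  have iff: "orbit Omega p \<in> points ?L \<longleftrightarrow> p \<in> points X_C3 \<and> alpha p = t" for p
  proof
    assume "orbit Omega p \<in> points ?L"
    then obtain q where "q \<in> points X_C3" "alpha q = t" "{p, sigma p} = {q, sigma q}"
      by (auto simp: pL orbit_Omega)
    moreover from this have "p = q \<or> p = sigma q" by auto
    ultimately show "p \<in> points X_C3 \<and> alpha p = t" by auto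
  qed (auto simp: pL)
  have "regular ?L = regular ?R"
  proof (intro equalityI subsetI)
    fix F assume "F \<in> regular ?L"
    then obtain H where H: "H \<in> regular X_quot"
      and F: "F = (\<lambda>q. if q \<in> points ?L then H q else 0)"
      by (auto simp: fibre_def subvariety_def)
    have "pullback X_C3 (orbit Omega) H \<in> regular X_C3"
      using H by (simp add: X_quot_def quotient_variety_def)
    moreover have "pullback (fibre X_C3 alpha t) (orbit Omega) F =
      (\<lambda>p. if p \<in> points X_C3 \<inter> {p. alpha p = t} then pullback X_C3 (orbit Omega) H p else 0)"
      by (auto simp: fun_eq_iff pullback_def pF F iff)
    ultimately have "pullback (fibre X_C3 alpha t) (orbit Omega) F \<in> regular (fibre X_C3 alpha t)"
      unfolding fibre_def subvariety_def[of X_C3] by auto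
    moreover have "F q = 0" if "q \<notin> points ?L" for q using that F by simp
    ultimately show "F \<in> regular ?R"
      unfolding quotient_variety_def using pL pF by auto
  next
    fix F assume F: "F \<in> regular ?R"
    have F0: "F q = 0" if "q \<notin> points ?L" for q
      using F that pL by (auto simp: quotient_variety_def pF)
    have "pullback (fibre X_C3 alpha t) (orbit Omega) F \<in> regular (fibre X_C3 alpha t)"
      using F by (simp add: quotient_variety_def)
    then obtain h where h: "h \<in> regular X_C3"
      and Fh: "pullback (fibre X_C3 alpha t) (orbit Omega) F =
        (\<lambda>p. if p \<in> points X_C3 \<inter> {p. alpha p = t} then h p else 0)"
      by (auto simp: fibre_def subvariety_def[of X_C3])
    obtain f where f: "f \<in> regular affine6" and hf: "\<And>p. p \<in> points X_C3 \<Longrightarrow> h p = f p"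
      using h by (auto simp: X_C3_def subvariety_def)
    have Ff: "F (orbit Omega p) = f p" if "p \<in> points X_C3" "alpha p = t" for p
    proof -
      have "F (orbit Omega p) = pullback (fibre X_C3 alpha t) (orbit Omega) F p"
        using that by (simp add: pullback_def pF)
      also have "\<dots> = f p" using that by (simp add: Fh hf)
      finally show ?thesis .
    qed
    define g where "g = (\<lambda>_. 1/2) * (f + (\<lambda>p. f (sigma p)))"
    have g: "g \<in> regular affine6"
      using f sigma_polynomial[OF f] unfolding g_def affine6_def affine_space_def
      by (simp add: polynomial_functions.intros(1,3,4))
    have gs: "g (sigma p) = g p" for p by (simp add: g_def add.commute)
    define H where "H q = (if q \<in> points X_quot then induced_map g q else 0)" for q
    have Ho: "H (orbit Omega p) = g p" if "p \<in> points X_C3" for p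
      using that by (simp add: H_def X_quot_def quotient_variety_def induced_map_def orbit_Omega gs)
    have "pullback X_C3 (orbit Omega) H = (\<lambda>p. if p \<in> points X_C3 then g p else 0)"
      by (auto simp: pullback_def Ho)
    also have "\<dots> \<in> regular X_C3"
      using g by (auto simp: X_C3_def subvariety_def)
    finally have "H \<in> regular X_quot"
      by (auto simp: X_quot_def quotient_variety_def H_def)
    moreover have "F = (\<lambda>q. if q \<in> points ?L then H q else 0)"
    proof
      fix q
      show "F q = (if q \<in> points ?L then H q else 0)"
      proof (cases "q \<in> points ?L")
        case True
        then obtain p where p: "q = orbit Omega p" "p \<in> points X_C3" "alpha p = t"
          by (auto simp: pL)
        have "F q = f p" using Ff p by simp
        moreover have "F q = f (sigma p)" using Ff[of "sigma p"] p by simp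
        ultimately show ?thesis using True p Ho[of p] by (simp add: g_def)
      qed (simp add: F0)
    qed
    ultimately show "F \<in> regular ?L"
      unfolding fibre_def subvariety_def by auto
  qed
  with pR show ?thesis by simp
qed

end

theory Submission
  imports Defs "HOL-Computational_Algebra.Fundamental_Theorem_Algebra"
begin

text \<open>
  In the coordinates \<open>s = 2y + x - t\<^sub>2/2\<close> and \<open>w = 2z\<close> the family is \<open>w\<^sup>2 = x s\<^sup>2 - P(x)\<close>, where \<open>P\<close> is
  a monic cubic polynomial whose coefficients depend on the parameters, and the involution is
  \<open>(s, w) \<mapsto> (-s, -w)\<close>. The invariants are generated by \<open>x\<close>, \<open>a = s\<^sup>2\<close>, \<open>c = s w\<close> and the parameters, so
  the quotient is the family of surfaces \<open>c\<^sup>2 = a (a x - P(x))\<close>: each is a double cover of the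
  \<open>(x, a)\<close>-plane, branched along the union of the line \<open>a = 0\<close> and the curve \<open>a x = P(x)\<close>
  (\<open>regular_X_quot\<close>, \<open>quot_coords_surj\<close>, \<open>quot_coords_inj\<close>). A complex cubic has a root, and
  at a root the two parts of the branch curve meet. The surface is singular above the
  intersection point, which is the image of a fixed point of the involution; no choice of the
  parameters removes it.

  That the point is singular in the sense of local algebra takes two computations on a double plane
  \<open>c\<^sup>2 = B(x, a)\<close>, whose regular functions have unique normal forms \<open>p + c q\<close>. The tangent space
  above a singular point of the branch curve is three-dimensional, because the
  equation \<open>c\<^sup>2 - B\<close> vanishes there to second order (\<open>derivation_in_tangent_space\<close>). The local dimension is
  at most two (\<open>local_dim_le_2\<close>): counting monomials shows that any three regular functions are
  algebraically dependent, and a chain of four irreducible closed sets would contradict this.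

  That the quotient is a deformation of the singularity of type \<open>D\<^sub>6\<close> rests on the same normal
  forms with coefficients in the base: the coordinate ring is free over the base, with basis
  \<open>x\<^sup>i a\<^sup>j\<close>, \<open>x\<^sup>i a\<^sup>j c\<close>, and the basis remains independent on each fibre. This gives flatness and
  reducedness of the fibres (\<open>flat_and_reduced_of_fibrewise_basis\<close>). The fibre at the origin is
  \<open>c\<^sup>2 = x a\<^sup>2 - a x\<^sup>3\<close>, and completing the square turns it into \<open>x\<^sup>5 + x y\<^sup>2 + z\<^sup>2 = 0\<close>
  (\<open>central_fibre\<close>).
\<close>

section \<open>Polynomial functions\<close>

lemma polynomial_functions_compose:
  assumes "f \<in> polynomial_functions K"
    and "\<And>g. g \<in> K \<Longrightarrow> (\<lambda>v. g (\<phi> v)) \<in> polynomial_functions L"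
  shows "(\<lambda>v. f (\<phi> v)) \<in> polynomial_functions L"
  using assms(1)
proof induction
  case (add f g)
  then show ?case using polynomial_functions.add[OF add.IH] by (simp add: plus_fun_def)
next
  case (mult f g)
  then show ?case using polynomial_functions.mult[OF mult.IH] by (simp add: times_fun_def)
qed (auto intro: assms(2) polynomial_functions.const)

named_theorems polynomial_intros

lemma polynomial_const [polynomial_intros]: "(\<lambda>_. c) \<in> polynomial_functions K"
  by (rule polynomial_functions.const)

lemma polynomial_add [polynomial_intros]:
  "f \<in> polynomial_functions K \<Longrightarrow> g \<in> polynomial_functions K
    \<Longrightarrow> (\<lambda>v. f v + g v) \<in> polynomial_functions K"
  using polynomial_functions.add[of f K g] by (simp add: plus_fun_def)

lemma polynomial_mult [polynomial_intros]:
  "f \<in> polynomial_functions K \<Longrightarrow> g \<in> polynomial_functions K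
    \<Longrightarrow> (\<lambda>v. f v * g v) \<in> polynomial_functions K"
  using polynomial_functions.mult[of f K g] by (simp add: times_fun_def)

lemma polynomial_uminus [polynomial_intros]:
  "f \<in> polynomial_functions K \<Longrightarrow> (\<lambda>v. - f v) \<in> polynomial_functions K"
  using polynomial_mult[OF polynomial_const[of "-1"], of f K] by simp

lemma polynomial_diff [polynomial_intros]:
  "f \<in> polynomial_functions K \<Longrightarrow> g \<in> polynomial_functions K
    \<Longrightarrow> (\<lambda>v. f v - g v) \<in> polynomial_functions K"
  using polynomial_add[OF _ polynomial_uminus, of f K g] by simp

lemma polynomial_divide_const [polynomial_intros]:
  "f \<in> polynomial_functions K \<Longrightarrow> (\<lambda>v. f v / c) \<in> polynomial_functions K"
  using polynomial_mult[OF _ polynomial_const[of "1/c"], of f K] by simp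

lemma polynomial_power [polynomial_intros]:
  "f \<in> polynomial_functions K \<Longrightarrow> (\<lambda>v. f v ^ n) \<in> polynomial_functions K"
  by (induction n) (auto intro: polynomial_intros)

lemma polynomial_sum [polynomial_intros]:
  "(\<And>i. i \<in> I \<Longrightarrow> f i \<in> polynomial_functions K)
    \<Longrightarrow> (\<lambda>v. \<Sum>i\<in>I. f i v) \<in> polynomial_functions K"
  by (induction I rule: infinite_finite_induct) (auto intro: polynomial_intros)

definition coords3 :: "(C3 \<Rightarrow> complex) set" where
  "coords3 = {\<lambda>(a, b, c). a, \<lambda>(a, b, c). b, \<lambda>(a, b, c). c}"

lemma regular_affine3: "regular affine3 = polynomial_functions coords3"
  by (simp add: affine3_def affine_space_def coords3_def)

lemma polynomial_coords3 [polynomial_intros]: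
  "(\<lambda>t. fst t) \<in> polynomial_functions coords3"
  "(\<lambda>t. fst (snd t)) \<in> polynomial_functions coords3"
  "(\<lambda>t. snd (snd t)) \<in> polynomial_functions coords3"
  by (rule polynomial_functions.coord; auto simp: coords3_def fun_eq_iff)+

lemma alpha_eq: "alpha p = snd (snd (snd p))"
  by (cases p) auto

lemma polynomial_coords6 [polynomial_intros]:
  "(\<lambda>p. fst p) \<in> polynomial_functions coords6"
  "(\<lambda>p. fst (snd p)) \<in> polynomial_functions coords6"
  "(\<lambda>p. fst (snd (snd p))) \<in> polynomial_functions coords6"
  "(\<lambda>p. fst (alpha p)) \<in> polynomial_functions coords6"
  "(\<lambda>p. fst (snd (alpha p))) \<in> polynomial_functions coords6"
  "(\<lambda>p. snd (snd (alpha p))) \<in> polynomial_functions coords6"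
  by (rule polynomial_functions.coord; auto simp: coords6_def fun_eq_iff alpha_eq)+

text \<open>
  The coordinate functions are case distinctions on nested tuples, awkward to match against a given
  expression; the composition principle is therefore restated with one function per coordinate.
\<close>

lemma polynomial_compose3:
  assumes "f \<in> polynomial_functions coords3"
    "(\<lambda>v. a v) \<in> polynomial_functions L" "(\<lambda>v. b v) \<in> polynomial_functions L"
    "(\<lambda>v. c v) \<in> polynomial_functions L"
  shows "(\<lambda>v. f (a v, b v, c v)) \<in> polynomial_functions L"
  by (rule polynomial_functions_compose[OF assms(1)]) (use assms(2-) in \<open>auto simp: coords3_def\<close>)

lemma polynomial_alpha [polynomial_intros]:
  assumes "f \<in> polynomial_functions coords3"
  shows "(\<lambda>p. f (alpha p)) \<in> polynomial_functions coords6"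
  using polynomial_compose3[OF assms polynomial_coords6(4-6)] by simp

lemma polynomial_compose6:
  assumes "f \<in> polynomial_functions coords6"
    "(\<lambda>v. a v) \<in> polynomial_functions L" "(\<lambda>v. b v) \<in> polynomial_functions L"
    "(\<lambda>v. c v) \<in> polynomial_functions L"
    "(\<lambda>v. fst (t v)) \<in> polynomial_functions L" "(\<lambda>v. fst (snd (t v))) \<in> polynomial_functions L"
    "(\<lambda>v. snd (snd (t v))) \<in> polynomial_functions L"
  shows "(\<lambda>v. f (a v, b v, c v, t v)) \<in> polynomial_functions L"
  by (rule polynomial_functions_compose[OF assms(1)])
    (use assms(2-) in \<open>auto simp: coords6_def case_prod_unfold\<close>)

lemma sum_fun_apply [simp]: "(\<Sum>i\<in>I. f i) v = (\<Sum>i\<in>I. f i v :: complex)"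
  by (induction I rule: infinite_finite_induct) auto

section \<open>Bivariate polynomials\<close>

text \<open>
  Polynomials in two variables are polynomials in the second variable whose coefficients are
  polynomials in the first, so that the ring structure and the absence of zero divisors come from
  the univariate theory.
\<close>

definition eval2 :: "complex poly poly \<Rightarrow> complex \<Rightarrow> complex \<Rightarrow> complex" where
  "eval2 p x a = poly (poly p [:a:]) x"

lemma eval2_simps [simp]:
  "eval2 0 x a = 0" "eval2 1 x a = 1"
  "eval2 (p + q) x a = eval2 p x a + eval2 q x a"
  "eval2 (p - q) x a = eval2 p x a - eval2 q x a"
  "eval2 (p * q) x a = eval2 p x a * eval2 q x a"
  "eval2 (pCons c p) x a = poly c x + a * eval2 p x a"
  "eval2 (smult c p) x a = poly c x * eval2 p x a"
  by (simp_all add: eval2_def)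

lemma eval2_sum [simp]: "eval2 (\<Sum>i\<in>I. p i) x a = (\<Sum>i\<in>I. eval2 (p i) x a)"
  by (simp add: eval2_def poly_sum)

lemma eval2_monom [simp]: "eval2 (monom (monom c i) j) x a = c * x ^ i * a ^ j"
  by (simp add: eval2_def poly_monom poly_power)

text \<open>
  For each value of the second variable a univariate polynomial in the first vanishes identically;
  hence every constant is a root of the outer polynomial, which has too many roots.
\<close>

lemma eval2_eq_0:
  assumes "\<And>x a. eval2 p x a = 0"
  shows "p = 0"
proof (rule ccontr)
  assume "p \<noteq> 0"
  have "poly p [:a:] = 0" for a
    using assms[of _ a] by (auto simp: eval2_def intro: poly_all_0_iff_0[THEN iffD1])
  then have "range (\<lambda>a. [:a:]) \<subseteq> {c. poly p c = 0}" by auto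
  moreover have "finite {c. poly p c = 0}" using \<open>p \<noteq> 0\<close> by (rule poly_roots_finite)
  ultimately have "finite (range (\<lambda>a::complex. [:a:]))" by (rule finite_subset)
  moreover have "inj (\<lambda>a::complex. [:a:])" by (auto simp: inj_def)
  ultimately show False using finite_imageD infinite_UNIV_char_0 by blast
qed

definition bidegree_le :: "nat \<Rightarrow> complex poly poly \<Rightarrow> bool" where
  "bidegree_le d p \<longleftrightarrow> degree p \<le> d \<and> (\<forall>j. degree (coeff p j) \<le> d)"

lemma bidegree_le_mono: "bidegree_le d p \<Longrightarrow> d \<le> e \<Longrightarrow> bidegree_le e p"
  by (meson bidegree_le_def order_trans)

lemma bidegree_le_add: "bidegree_le d p \<Longrightarrow> bidegree_le d q \<Longrightarrow> bidegree_le d (p + q)"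
  by (simp add: bidegree_le_def degree_add_le)

lemma bidegree_le_mult:
  assumes "bidegree_le d p" "bidegree_le e q" shows "bidegree_le (d + e) (p * q)"
  unfolding bidegree_le_def
proof (intro conjI allI)
  show "degree (p * q) \<le> d + e"
    using assms degree_mult_le[of p q] by (simp add: bidegree_le_def)
  have "degree (coeff p i * coeff q k) \<le> d + e" for i k
    using assms degree_mult_le[of "coeff p i" "coeff q k"] unfolding bidegree_le_def
    by (meson add_mono order_trans)
  then show "degree (coeff (p * q) j) \<le> d + e" for j
    unfolding coeff_mult by (intro degree_sum_le) auto
qed

lemma bidegree_le_exists: "\<exists>d. bidegree_le d p"
proof -
  define d where "d = Max (insert (degree p) ((\<lambda>j. degree (coeff p j)) ` {..degree p}))"
  have "degree p \<le> d" by (simp add: d_def)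
  moreover have "degree (coeff p j) \<le> d" for j
  proof (cases "j \<le> degree p")
    case True then show ?thesis unfolding d_def by (intro Max_ge) auto
  qed (simp add: coeff_eq_0)
  ultimately show ?thesis by (auto simp: bidegree_le_def)
qed

lemma eval2_expand:
  assumes "bidegree_le d p"
  shows "eval2 p x a = (\<Sum>i\<le>d. \<Sum>j\<le>d. coeff (coeff p j) i * (x ^ i * a ^ j))"
proof -
  have "p = (\<Sum>j\<le>d. monom (coeff p j) j)"
    using assms by (metis bidegree_le_def poly_as_sum_of_monoms')
  moreover have "coeff p j = (\<Sum>i\<le>d. monom (coeff (coeff p j) i) i)" for j
    using assms by (metis bidegree_le_def poly_as_sum_of_monoms')
  ultimately have "eval2 p x a = eval2 (\<Sum>j\<le>d. monom (\<Sum>i\<le>d. monom (coeff (coeff p j) i) i) j) x a"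
    by simp
  also have "\<dots> = (\<Sum>j\<le>d. (\<Sum>i\<le>d. coeff (coeff p j) i * x ^ i) * a ^ j)"
    by (simp add: eval2_def poly_sum poly_monom poly_power)
  also have "\<dots> = (\<Sum>i\<le>d. \<Sum>j\<le>d. coeff (coeff p j) i * (x ^ i * a ^ j))"
    by (subst sum.swap) (simp add: sum_distrib_right mult.assoc)
  finally show ?thesis .
qed

section \<open>Double covers of the plane\<close>

lemma dependent_family:
  fixes g :: "'i \<Rightarrow> 'b \<Rightarrow> complex" and T :: "('b \<Rightarrow> complex) set"
  assumes I: "finite I" and T: "finite T"
    and g: "\<And>i. i \<in> I \<Longrightarrow> g i \<in> module.span (\<lambda>c D f. c * D f) T"
    and card: "card T < card I"
  shows "\<exists>c. (\<exists>i\<in>I. c i \<noteq> 0) \<and> (\<forall>v. (\<Sum>i\<in>I. c i * g i v) = 0)"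
proof -
  interpret F: vector_space "\<lambda>(c::complex) (D :: 'b \<Rightarrow> complex) f. c * D f"
    by (rule vector_space_complex_fun)
  show ?thesis
  proof (cases "inj_on g I")
    case False
    then obtain i k where ik: "i \<in> I" "k \<in> I" "i \<noteq> k" "g i = g k" by (auto simp: inj_on_def)
    define c where "c l = (if l = i then 1 else if l = k then -1 else 0 :: complex)" for l
    have "(\<Sum>l\<in>I. c l * g l v) = 0" for v
    proof -
      have "(\<Sum>l\<in>I. c l * g l v) = (\<Sum>l\<in>{i,k}. c l * g l v)"
        using I ik by (intro sum.mono_neutral_right) (auto simp: c_def)
      also have "\<dots> = 0" using ik by (simp add: c_def)
      finally show ?thesis .
    qed
    moreover have "c i \<noteq> 0" by (simp add: c_def)
    ultimately show ?thesis using ik by blast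
  next
    case True
    have "F.dependent (g ` I)"
    proof (rule ccontr)
      assume "F.independent (g ` I)"
      then have "card (g ` I) \<le> card T"
        using F.independent_span_bound[OF T] g by blast
      with True card show False by (simp add: card_image)
    qed
    then obtain u where u: "\<exists>v\<in>g ` I. u v \<noteq> 0"
      "(\<Sum>v\<in>g ` I. (\<lambda>f. u v * v f)) = 0"
      using F.dependent_finite[of "g ` I"] I by auto
    have "(\<Sum>i\<in>I. u (g i) * g i v) = 0" for v
      using fun_cong[OF u(2), of v] True by (simp add: sum.reindex)
    then show ?thesis using u(1) by (intro exI[of _ "\<lambda>i. u (g i)"]) auto
  qed
qed

text \<open>
  A double plane is a surface \<open>c\<^sup>2 = B(x, a)\<close>, a twofold cover of the plane branched along
  the curve \<open>B = 0\<close>. The surface is given abstractly by three coordinate functions, because the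
  points it is applied to are orbits. All arguments
  below take place in the ring of regular functions, in which \<open>c\<^sup>2\<close> can be eliminated, leaving normal
  forms \<open>p + c q\<close>.
\<close>

locale double_plane =
  fixes V :: "'a variety" and X A C :: "'a \<Rightarrow> complex" and B :: "complex poly poly"
  assumes branch_nonzero: "B \<noteq> 0"
    and on_surface: "v \<in> points V \<Longrightarrow> C v ^ 2 = eval2 B (X v) (A v)"
    and covers: "c ^ 2 = eval2 B x a \<Longrightarrow> \<exists>v\<in>points V. X v = x \<and> A v = a \<and> C v = c"
    and regular_iff: "f \<in> regular V \<longleftrightarrow> (\<exists>p q. f =
      (\<lambda>v. if v \<in> points V then eval2 p (X v) (A v) + C v * eval2 q (X v) (A v) else 0))"
begin

definition normal_form :: "complex poly poly \<Rightarrow> complex poly poly \<Rightarrow> 'a \<Rightarrow> complex" where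
  "normal_form p q = (\<lambda>v. if v \<in> points V then eval2 p (X v) (A v) + C v * eval2 q (X v) (A v) else 0)"

lemma regular_eq_normal_form: "f \<in> regular V \<longleftrightarrow> (\<exists>p q. f = normal_form p q)"
  by (simp add: regular_iff normal_form_def)

lemma normal_form_regular [simp]: "normal_form p q \<in> regular V"
  by (auto simp: regular_eq_normal_form)

text \<open>
  The two points \<open>(x, a, c)\<close> and \<open>(x, a, -c)\<close> of the surface separate \<open>p\<close> from \<open>c q\<close>; the latter
  vanishes only if \<open>B q\<^sup>2 = 0\<close>, that is, \<open>q = 0\<close>.
\<close>

lemma normal_form_unique:
  assumes "\<And>v. v \<in> points V \<Longrightarrow> eval2 p (X v) (A v) + C v * eval2 q (X v) (A v) = 0"
  shows "p = 0 \<and> q = 0"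
proof -
  have *: "eval2 p x a = 0 \<and> eval2 (B * q * q) x a = 0" for x a
  proof -
    define c where "c = csqrt (eval2 B x a)"
    have c: "c ^ 2 = eval2 B x a" "(- c) ^ 2 = eval2 B x a" by (simp_all add: c_def)
    obtain v1 where "v1 \<in> points V" "X v1 = x" "A v1 = a" "C v1 = c"
      using covers[OF c(1)] by auto
    then have 1: "eval2 p x a + c * eval2 q x a = 0" using assms[of v1] by simp
    obtain v2 where "v2 \<in> points V" "X v2 = x" "A v2 = a" "C v2 = - c"
      using covers[OF c(2)] by auto
    then have 2: "eval2 p x a + (- c) * eval2 q x a = 0" using assms[of v2] by simp
    have "2 * eval2 p x a = (eval2 p x a + c * eval2 q x a) + (eval2 p x a + (- c) * eval2 q x a)"
      by simp
    also have "\<dots> = 0" by (simp only: 1 2 add_0)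
    finally have "2 * eval2 p x a = 0" .
    then have p: "eval2 p x a = 0" by simp
    have "c * eval2 q x a = 0" using 1 unfolding p by simp
    then have "c ^ 2 * eval2 q x a * eval2 q x a = 0" by (auto simp: power2_eq_square)
    with p show ?thesis unfolding c by simp
  qed
  have "p = 0" "B * q * q = 0" using * by (blast intro: eval2_eq_0)+
  then show ?thesis using branch_nonzero by simp
qed

lemma normal_form_add: "normal_form p q + normal_form p' q' = normal_form (p + p') (q + q')"
  by (auto simp: normal_form_def fun_eq_iff algebra_simps)

lemma normal_form_diff: "normal_form p q - normal_form p' q' = normal_form (p - p') (q - q')"
  by (auto simp: normal_form_def fun_eq_iff algebra_simps)

lemma normal_form_scale: "(\<lambda>v. c * normal_form p q v) = normal_form ([:[:c:]:] * p) ([:[:c:]:] * q)"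
  by (auto simp: normal_form_def fun_eq_iff algebra_simps)

lemma normal_form_mult: "normal_form p q * normal_form p' q' = normal_form (p * p' + B * q * q') (p * q' + q * p')"
proof
  fix v
  show "(normal_form p q * normal_form p' q') v = normal_form (p * p' + B * q * q') (p * q' + q * p') v"
    by (auto simp: normal_form_def on_surface[symmetric] algebra_simps power2_eq_square)
qed

lemma normal_form_inject: "normal_form p q = normal_form p' q' \<longleftrightarrow> p = p' \<and> q = q'"
proof
  assume "normal_form p q = normal_form p' q'"
  then have "normal_form (p - p') (q - q') v = 0" for v by (simp flip: normal_form_diff)
  then have "p - p' = 0 \<and> q - q' = 0"
    by (intro normal_form_unique) (metis normal_form_def)
  then show "p = p' \<and> q = q'" by simp
qed simp

text \<open>
  Regular functions vanish outside the surface, so constants need not be among them. Sums with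
  constant terms are formed among all functions and cut down to the surface afterwards.
\<close>

definition lift :: "('a \<Rightarrow> complex) \<Rightarrow> 'a \<Rightarrow> complex" where
  "lift g = (\<lambda>v. if v \<in> points V then g v else 0)"

lemma lift_const: "lift (\<lambda>_. c) \<in> regular V"
proof -
  have "lift (\<lambda>_. c) = normal_form [:[:c:]:] 0" by (auto simp: lift_def normal_form_def)
  then show ?thesis by simp
qed

lemma lift_regular: "f \<in> regular V \<Longrightarrow> lift f = f"
  by (auto simp: regular_eq_normal_form normal_form_def lift_def)

lemma lift_add:
  assumes "lift f \<in> regular V" "lift g \<in> regular V"
  shows "lift (\<lambda>v. f v + g v) \<in> regular V"
proof -
  obtain p q p' q' where "lift f = normal_form p q" "lift g = normal_form p' q'"
    using assms regular_eq_normal_form by metis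
  moreover have "lift (\<lambda>v. f v + g v) = lift f + lift g" by (simp add: lift_def fun_eq_iff)
  ultimately show ?thesis by (simp only: normal_form_add normal_form_regular)
qed

lemma lift_mult:
  assumes "lift f \<in> regular V" "lift g \<in> regular V"
  shows "lift (\<lambda>v. f v * g v) \<in> regular V"
proof -
  obtain p q p' q' where "lift f = normal_form p q" "lift g = normal_form p' q'"
    using assms regular_eq_normal_form by metis
  moreover have "lift (\<lambda>v. f v * g v) = lift f * lift g" by (simp add: lift_def fun_eq_iff)
  ultimately show ?thesis by (simp only: normal_form_mult normal_form_regular)
qed

lemma lift_power: "lift f \<in> regular V \<Longrightarrow> lift (\<lambda>v. f v ^ n) \<in> regular V"
  by (induction n) (auto intro: lift_const lift_mult)

lemma lift_sum: "(\<And>i. i \<in> I \<Longrightarrow> lift (f i) \<in> regular V) \<Longrightarrow> lift (\<lambda>v. \<Sum>i\<in>I. f i v) \<in> regular V"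
  by (induction I rule: infinite_finite_induct) (auto intro: lift_const lift_add)

section \<open>Double planes have dimension at most two\<close>

text \<open>
  The filtration of the coordinate ring by bidegree. It is multiplicative up to a constant shift
  (\<open>bounded_mult\<close>), and its pieces grow only quadratically (\<open>card_monomials\<close>).
\<close>

definition bounded :: "nat \<Rightarrow> ('a \<Rightarrow> complex) set" where
  "bounded d = {normal_form p q | p q. bidegree_le d p \<and> bidegree_le d q}"

definition monomials :: "nat \<Rightarrow> ('a \<Rightarrow> complex) set" where
  "monomials d = (\<lambda>(i, j). normal_form (monom (monom 1 i) j) 0) ` ({..d} \<times> {..d})
    \<union> (\<lambda>(i, j). normal_form 0 (monom (monom 1 i) j)) ` ({..d} \<times> {..d})"

lemma card_monomials: "finite (monomials d)" "card (monomials d) \<le> 2 * (d + 1) ^ 2"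
proof -
  show "finite (monomials d)" by (simp add: monomials_def)
  have "card (monomials d) \<le> card ({..d} \<times> {..d}) + card ({..d} \<times> {..d})"
    unfolding monomials_def
    by (rule order_trans[OF card_Un_le]) (intro add_mono card_image_le; simp)
  then show "card (monomials d) \<le> 2 * (d + 1) ^ 2"
    by (simp add: card_cartesian_product power2_eq_square)
qed

lemma bounded_span:
  assumes "f \<in> bounded d" shows "f \<in> module.span (\<lambda>c D f. c * D f) (monomials d)"
proof -
  interpret F: vector_space "\<lambda>(c::complex) (D :: 'a \<Rightarrow> complex) f. c * D f"
    by (rule vector_space_complex_fun)
  obtain p q where f: "f = normal_form p q" and p: "bidegree_le d p" and q: "bidegree_le d q"
    using assms by (auto simp: bounded_def)
  have "f = (\<Sum>i\<le>d. \<Sum>j\<le>d. (\<lambda>v. coeff (coeff p j) i * normal_form (monom (monom 1 i) j) 0 v))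
      + (\<Sum>i\<le>d. \<Sum>j\<le>d. (\<lambda>v. coeff (coeff q j) i * normal_form 0 (monom (monom 1 i) j) v))"
    by (auto simp: f normal_form_def fun_eq_iff eval2_expand[OF p] eval2_expand[OF q]
        sum_distrib_left algebra_simps)
  also have "\<dots> \<in> F.span (monomials d)"
    by (intro F.span_add F.span_sum F.span_scale F.span_base) (auto simp: monomials_def)
  finally show ?thesis .
qed

lemma bounded_mult:
  assumes "f \<in> bounded d" "g \<in> bounded e" "bidegree_le m B"
  shows "f * g \<in> bounded (d + e + m)"
proof -
  obtain p q p' q' where f: "f = normal_form p q" "bidegree_le d p" "bidegree_le d q"
    and g: "g = normal_form p' q'" "bidegree_le e p'" "bidegree_le e q'"
    using assms by (auto simp: bounded_def)
  have "bidegree_le (m + d + e) (B * q * q')"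
    using f g assms by (intro bidegree_le_mult)
  moreover have "bidegree_le (d + e) (p * p')" "bidegree_le (d + e) (p * q')" "bidegree_le (d + e) (q * p')"
    using f g by (auto intro: bidegree_le_mult)
  ultimately have "bidegree_le (d + e + m) (p * p' + B * q * q')" "bidegree_le (d + e + m) (p * q' + q * p')"
    by (auto intro!: bidegree_le_add elim!: bidegree_le_mono)
  then show ?thesis unfolding f g normal_form_mult bounded_def by blast
qed

lemma regular_bounded: "f \<in> regular V \<Longrightarrow> \<exists>d. f \<in> bounded d"
proof -
  assume "f \<in> regular V"
  then obtain p q where f: "f = normal_form p q" by (auto simp: regular_eq_normal_form)
  obtain d e where "bidegree_le d p" "bidegree_le e q" using bidegree_le_exists by blast
  then have "bidegree_le (max d e) p" "bidegree_le (max d e) q" by (auto elim!: bidegree_le_mono)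
  then show ?thesis using f by (auto simp: bounded_def)
qed

lemma bounded_mono: "f \<in> bounded d \<Longrightarrow> d \<le> e \<Longrightarrow> f \<in> bounded e"
  using bidegree_le_mono by (fastforce simp: bounded_def)

text \<open>
  Any three regular functions on a double plane are algebraically dependent: the \<open>N\<^sup>3\<close> monomials
  with exponents below \<open>N\<close> lie in a space whose dimension grows only like \<open>N\<^sup>2\<close>. The relation is
  written as a nested polynomial, the form in which \<open>no_chain_of_length_three\<close> peels off one
  variable at a time.
\<close>

lemma algebraic_dependence:
  assumes "f \<in> regular V" "g \<in> regular V" "h \<in> regular V"
  shows "\<exists>N c. (\<exists>i<N. \<exists>j<N. \<exists>k<N. c i j k \<noteq> (0::complex)) \<and>
    (\<forall>v\<in>points V. (\<Sum>i<N. f v ^ i * (\<Sum>j<N. g v ^ j * (\<Sum>k<N. h v ^ k * c i j k))) = 0)"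
proof -
  obtain d1 d2 d3 m where d: "f \<in> bounded d1" "g \<in> bounded d2" "h \<in> bounded d3" and m: "bidegree_le m B"
    using assms regular_bounded bidegree_le_exists by meson
  define K where "K = d1 + d2 + d3 + m"
  have fgh: "f \<in> bounded (d1 + d2 + d3)" "g \<in> bounded (d1 + d2 + d3)" "h \<in> bounded (d1 + d2 + d3)"
    using d by (auto elim!: bounded_mono)
  have step: "u * w \<in> bounded (Suc n * K)"
    if "u \<in> bounded (d1 + d2 + d3)" "w \<in> bounded (n * K)" for u w n
    using bounded_mult[OF that m] by (rule bounded_mono) (simp add: K_def)
  \<comment> \<open>products of functions rather than of values, starting from the unit of the coordinate ring\<close>
  define M where "M i j k = ((\<lambda>u. f * u) ^^ i) (((\<lambda>u. g * u) ^^ j) (((\<lambda>u. h * u) ^^ k) (normal_form 1 0)))"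
    for i j k
  have iter: "((\<lambda>u. f' * u) ^^ i) w \<in> bounded ((i + n) * K)"
    if "f' \<in> bounded (d1 + d2 + d3)" "w \<in> bounded (n * K)" for f' i w n
    using that(2) by (induction i) (use step[OF that(1)] in auto)
  have M: "M i j k \<in> bounded ((i + (j + (k + 0))) * K)" for i j k
  proof -
    have "normal_form 1 0 \<in> bounded 0"
      unfolding bounded_def by (intro CollectI exI[of _ 1] exI[of _ 0]) (simp add: bidegree_le_def)
    then show ?thesis unfolding M_def by (intro iter fgh) simp
  qed
  have iter_eval: "((\<lambda>u. f' * u) ^^ i) w v = f' v ^ i * w v" for f' w :: "'a \<Rightarrow> complex" and i v
    by (induction i) (auto simp: algebra_simps)
  have M_eval: "M i j k v = f v ^ i * (g v ^ j * h v ^ k)" if "v \<in> points V" for i j k v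
    using that by (simp add: M_def iter_eval normal_form_def)
  \<comment> \<open>any \<open>N\<close> with \<open>2 (3 N K + 1)\<^sup>2 < N\<^sup>3\<close> will do\<close>
  define N where "N = 2 * (3 * K + 1) ^ 2 + 1"
  have N1: "1 \<le> N" "2 * (3 * K + 1) ^ 2 < N" by (simp_all add: N_def)
  define I where "I = {..<N} \<times> {..<N} \<times> {..<N}"
  have "\<exists>c. (\<exists>l\<in>I. c l \<noteq> 0) \<and> (\<forall>v. (\<Sum>l\<in>I. c l * (\<lambda>(i, j, k). M i j k) l v) = 0)"
  proof (rule dependent_family)
    show "(\<lambda>(i, j, k). M i j k) l \<in> module.span (\<lambda>c D f. c * D f) (monomials (3 * N * K))" if lI: "l \<in> I" for l
    proof -
      obtain i j k where l: "l = (i, j, k)" "i < N" "j < N" "k < N"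
        using lI unfolding I_def by blast
      then have "(i + (j + (k + 0))) * K \<le> 3 * N * K" by (intro mult_right_mono) auto
      then show ?thesis using bounded_span[OF bounded_mono[OF M]] l by auto
    qed
    have le: "3 * N * K + 1 \<le> N * (3 * K + 1)" using N1 by (simp add: distrib_left ac_simps)
    have "card (monomials (3 * N * K)) \<le> 2 * (3 * N * K + 1) ^ 2" by (rule card_monomials)
    also have "\<dots> \<le> 2 * (N * (3 * K + 1)) ^ 2"
      using le by (intro mult_left_mono power_mono) simp_all
    also have "\<dots> = N ^ 2 * (2 * (3 * K + 1) ^ 2)" by (simp only: power_mult_distrib mult.left_commute)
    also have "\<dots> < N ^ 2 * N" using N1 by (intro mult_strict_left_mono) simp_all
    also have "\<dots> = card I" by (simp add: I_def card_cartesian_product power2_eq_square)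
    finally show "card (monomials (3 * N * K)) < card I" .
  qed (auto simp: I_def card_monomials)
  then obtain c where c: "\<exists>l\<in>I. c l \<noteq> 0" "\<And>v. (\<Sum>l\<in>I. c l * (\<lambda>(i, j, k). M i j k) l v) = 0"
    by blast
  have "(\<Sum>i<N. f v ^ i * (\<Sum>j<N. g v ^ j * (\<Sum>k<N. h v ^ k * c (i, j, k)))) = 0" if v: "v \<in> points V" for v
  proof -
    have "(\<Sum>i<N. f v ^ i * (\<Sum>j<N. g v ^ j * (\<Sum>k<N. h v ^ k * c (i, j, k))))
       = (\<Sum>i<N. \<Sum>j<N. \<Sum>k<N. c (i, j, k) * M i j k v)"
      by (simp add: M_eval[OF v] sum_distrib_left algebra_simps)
    also have "\<dots> = (\<Sum>l\<in>I. c l * (\<lambda>(i, j, k). M i j k) l v)"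
      by (simp add: I_def sum.cartesian_product case_prod_unfold)
    finally show ?thesis using c(2) by simp
  qed
  moreover have "\<exists>i<N. \<exists>j<N. \<exists>k<N. c (i, j, k) \<noteq> 0" using c(1) by (auto simp: I_def)
  ultimately show ?thesis by (intro exI[of _ N] exI[of _ "\<lambda>i j k. c (i, j, k)"]) auto
qed

lemma irreducible_cancel:
  assumes Z: "irreducible_closed V Z"
    and u: "u \<in> regular V" and g: "lift g \<in> regular V"
    and zero: "\<And>v. v \<in> Z \<Longrightarrow> u v = 0 \<or> g v = 0"
    and nz: "w \<in> Z" "u w \<noteq> 0" and v: "v \<in> Z"
  shows "g v = 0"
proof -
  have ZV: "Z \<subseteq> points V"
    using Z by (auto simp: irreducible_closed_def zariski_closed_def)
  have cl: "zariski_closed V {v \<in> points V. f v = 0}" if "f \<in> regular V" for f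
    unfolding zariski_closed_def using that by (intro exI[of _ "{f}"]) auto
  have "Z \<subseteq> {v \<in> points V. u v = 0} \<union> {v \<in> points V. lift g v = 0}"
    using zero ZV by (auto simp: lift_def)
  then have "Z \<subseteq> {v \<in> points V. u v = 0} \<or> Z \<subseteq> {v \<in> points V. lift g v = 0}"
    using Z cl[OF u] cl[OF g] unfolding irreducible_closed_def by blast
  then have "lift g v = 0" "v \<in> points V" using nz v ZV by auto
  then show ?thesis by (simp add: lift_def)
qed

text \<open>
  The step that lowers the dimension: a polynomial relation in \<open>u\<close> on an irreducible set where \<open>u\<close>
  does not vanish identically can be divided by the power of \<open>u\<close> dividing it; on the zeros of \<open>u\<close>
  only the lowest coefficient of the relation then remains.
\<close>

lemma lowest_coefficient_vanishes:
  assumes Z: "irreducible_closed V Z"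
    and u: "u \<in> regular V" and a: "\<And>i. lift (a i) \<in> regular V"
    and sum: "\<And>v. v \<in> Z \<Longrightarrow> (\<Sum>i<N. u v ^ i * a i v) = 0"
    and low: "\<And>i v. i < m \<Longrightarrow> a i v = 0" and m: "m < N"
    and nz: "w \<in> Z" "u w \<noteq> 0" and v: "v \<in> Z" "u v = 0"
  shows "a m v = 0"
proof -
  define g where "g v = (\<Sum>i=m..<N. u v ^ (i - m) * a i v)" for v
  have fac: "(\<Sum>i<N. u v ^ i * a i v) = u v ^ m * g v" for v
  proof -
    have "(\<Sum>i<N. u v ^ i * a i v) = (\<Sum>i=m..<N. u v ^ i * a i v)"
      by (rule sum.mono_neutral_right) (auto simp: low)
    also have "\<dots> = u v ^ m * g v"
      unfolding g_def sum_distrib_left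
      by (intro sum.cong) (auto simp flip: mult.assoc power_add)
    finally show ?thesis .
  qed
  have "lift g \<in> regular V"
    unfolding g_def using u a by (intro lift_sum lift_mult lift_power) (auto simp: lift_regular)
  then have "g v = 0"
    using sum fac nz v by (intro irreducible_cancel[OF Z u]) auto
  also have "g v = (\<Sum>i=m..<N. if i = m then a m v else 0)"
    unfolding g_def using v by (intro sum.cong) auto
  finally show ?thesis using m by simp
qed

text \<open>
  Choose functions \<open>f, g, h\<close> that vanish on \<open>Z2, Z1, Z0\<close> respectively, but not on the next larger
  set. Restricting an algebraic relation among them successively to \<open>Z2\<close>, \<open>Z1\<close> and \<open>Z0\<close> removes one
  function each time, and leaves the coefficient of the lexicographically smallest monomial, which
  would have to be zero.
\<close>

lemma no_chain_of_length_three: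
  assumes Z: "irreducible_closed V Z3" "irreducible_closed V Z2" "irreducible_closed V Z1"
    "irreducible_closed V Z0" and chain: "Z0 \<subset> Z1" "Z1 \<subset> Z2" "Z2 \<subset> Z3"
  shows False
proof -
  have sep: "\<exists>f\<in>regular V. (\<forall>v\<in>Y. f v = 0) \<and> (\<exists>w\<in>Z. f w \<noteq> 0)"
    if Y: "irreducible_closed V Y" and Z: "irreducible_closed V Z" and "Y \<subset> Z" for Y Z
  proof -
    obtain S where S: "S \<subseteq> regular V" "Y = {p \<in> points V. \<forall>f\<in>S. f p = 0}"
      using Y by (auto simp: irreducible_closed_def zariski_closed_def)
    obtain w where w: "w \<in> Z" "w \<notin> Y" using \<open>Y \<subset> Z\<close> by auto
    have "w \<in> points V"
      using Z w by (auto simp: irreducible_closed_def zariski_closed_def)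
    with w S obtain f where "f \<in> S" "f w \<noteq> 0" by auto
    with S w show ?thesis by (intro bexI[of _ f]) auto
  qed
  have Z3V: "Z3 \<subseteq> points V"
    using Z by (auto simp: irreducible_closed_def zariski_closed_def)
  obtain f w3 where f: "f \<in> regular V" "\<And>v. v \<in> Z2 \<Longrightarrow> f v = 0" "w3 \<in> Z3" "f w3 \<noteq> 0"
    using sep[OF Z(2,1) chain(3)] by blast
  obtain g w2 where g: "g \<in> regular V" "\<And>v. v \<in> Z1 \<Longrightarrow> g v = 0" "w2 \<in> Z2" "g w2 \<noteq> 0"
    using sep[OF Z(3,2) chain(2)] by blast
  obtain h w1 where h: "h \<in> regular V" "\<And>v. v \<in> Z0 \<Longrightarrow> h v = 0" "w1 \<in> Z1" "h w1 \<noteq> 0"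
    using sep[OF Z(4,3) chain(1)] by blast
  obtain w0 where w0: "w0 \<in> Z0" using Z by (auto simp: irreducible_closed_def)
  obtain N c where nz: "\<exists>i<N. \<exists>j<N. \<exists>k<N. c i j k \<noteq> (0::complex)"
    and rel: "\<And>v. v \<in> points V \<Longrightarrow>
      (\<Sum>i<N. f v ^ i * (\<Sum>j<N. g v ^ j * (\<Sum>k<N. h v ^ k * c i j k))) = 0"
    using algebraic_dependence[OF f(1) g(1) h(1)] by blast
  define i0 where "i0 = (LEAST i. i < N \<and> (\<exists>j<N. \<exists>k<N. c i j k \<noteq> 0))"
  have i0: "i0 < N" "\<exists>j<N. \<exists>k<N. c i0 j k \<noteq> 0"
    using LeastI_ex[of "\<lambda>i. i < N \<and> (\<exists>j<N. \<exists>k<N. c i j k \<noteq> 0)"] nz by (auto simp: i0_def)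
  have i0_min: "c i j k = 0" if "i < i0" "j < N" "k < N" for i j k
    using not_less_Least[of i "\<lambda>i. i < N \<and> (\<exists>j<N. \<exists>k<N. c i j k \<noteq> 0)"] that i0 by (auto simp: i0_def)
  define j0 where "j0 = (LEAST j. j < N \<and> (\<exists>k<N. c i0 j k \<noteq> 0))"
  have j0: "j0 < N" "\<exists>k<N. c i0 j0 k \<noteq> 0"
    using LeastI_ex[of "\<lambda>j. j < N \<and> (\<exists>k<N. c i0 j k \<noteq> 0)"] i0 by (auto simp: j0_def)
  have j0_min: "c i0 j k = 0" if "j < j0" "k < N" for j k
    using not_less_Least[of j "\<lambda>j. j < N \<and> (\<exists>k<N. c i0 j k \<noteq> 0)"] that j0 by (auto simp: j0_def)
  define k0 where "k0 = (LEAST k. k < N \<and> c i0 j0 k \<noteq> 0)"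
  have k0: "k0 < N" "c i0 j0 k0 \<noteq> 0"
    using LeastI_ex[of "\<lambda>k. k < N \<and> c i0 j0 k \<noteq> 0"] j0 by (auto simp: k0_def)
  have k0_min: "c i0 j0 k = 0" if "k < k0" for k
    using not_less_Least[of k "\<lambda>k. k < N \<and> c i0 j0 k \<noteq> 0"] that k0 by (auto simp: k0_def)
  have reg: "lift (\<lambda>v. \<Sum>k<N. h v ^ k * c i j k) \<in> regular V" for i j
    using h(1) by (intro lift_sum lift_mult lift_power lift_const) (simp add: lift_regular)
  have reg': "lift (\<lambda>v. \<Sum>j<N. g v ^ j * (\<Sum>k<N. h v ^ k * c i j k)) \<in> regular V" for i
    using g(1) by (intro lift_sum lift_mult[OF _ reg] lift_power) (simp add: lift_regular)
  have 1: "(\<Sum>j<N. g v ^ j * (\<Sum>k<N. h v ^ k * c i0 j k)) = 0" if "v \<in> Z2" for v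
    by (rule lowest_coefficient_vanishes[OF Z(1) f(1) reg' rel _ i0(1) f(3,4)])
      (use that chain Z3V f(2) i0_min in auto)
  have 2: "(\<Sum>k<N. h v ^ k * c i0 j0 k) = 0" if "v \<in> Z1" for v
    by (rule lowest_coefficient_vanishes[OF Z(2) g(1) reg 1 _ j0(1) g(3,4)])
      (use that chain g(2) j0_min in auto)
  have "c i0 j0 k0 = 0"
    by (rule lowest_coefficient_vanishes[OF Z(3) h(1) lift_const 2 _ k0(1) h(3,4), where v = w0])
      (use w0 chain h(2) k0_min in auto)
  with k0 show False by simp
qed

lemma local_dim_le_2: "local_dim V v \<le> 2"
  unfolding local_dim_def
proof (rule Sup_least, clarify)
  fix n and Z :: "nat \<Rightarrow> 'a set"
  assume Z: "\<forall>i\<le>n. irreducible_closed V (Z i) \<and> v \<in> Z i" and chain: "\<forall>i<n. Z i \<subset> Z (Suc i)"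
  show "enat n \<le> 2"
  proof (rule ccontr)
    assume "\<not> enat n \<le> 2"
    then have "3 \<le> n" by (simp add: numeral_eq_enat)
    then have "irreducible_closed V (Z 3)" "irreducible_closed V (Z 2)" "irreducible_closed V (Z 1)"
      "irreducible_closed V (Z 0)" "Z 0 \<subset> Z 1" "Z 1 \<subset> Z 2" "Z 2 \<subset> Z 3"
      using Z chain by (auto simp: eval_nat_numeral)
    then show False by (rule no_chain_of_length_three)
  qed
qed

section \<open>Tangent spaces of double planes\<close>

text \<open>
  The pair \<open>(p, q)\<close> of the normal form \<open>p + c q\<close>.
\<close>

definition rep :: "('a \<Rightarrow> complex) \<Rightarrow> complex poly poly \<times> complex poly poly" where
  "rep f = (THE r. f = normal_form (fst r) (snd r))"

lemma rep_normal_form [simp]: "rep (normal_form p q) = (p, q)"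
  unfolding rep_def by (rule the_equality) (auto simp: normal_form_inject prod_eq_iff)

text \<open>
  The value at \<open>p + c q\<close> of the derivative in direction \<open>(l, m, n)\<close> at the point \<open>(x, a, 0)\<close>.
\<close>

definition derivation :: "complex \<Rightarrow> complex \<Rightarrow> complex \<Rightarrow> complex \<Rightarrow> complex \<Rightarrow> ('a \<Rightarrow> complex) \<Rightarrow> complex" where
  "derivation x a l m n f = (if f \<in> regular V then
      l * poly (pderiv (poly (fst (rep f)) [:a:])) x + m * eval2 (pderiv (fst (rep f))) x a
      + n * eval2 (snd (rep f)) x a else 0)"

lemma derivation_normal_form: "derivation x a l m n (normal_form p q) =
    l * poly (pderiv (poly p [:a:])) x + m * eval2 (pderiv p) x a + n * eval2 q x a"
  by (simp add: derivation_def)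

text \<open>
  The product of normal forms differs from the product in the polynomial ring by the term
  \<open>B q q'\<close>. At a singular point of the branch curve this term vanishes to second order, so all
  three directional derivatives of the ambient space satisfy the product rule.
\<close>

lemma derivation_in_tangent_space:
  assumes v: "v \<in> points V" "C v = 0" and x: "x = X v" and a: "a = A v"
    and sing: "poly (pderiv (poly B [:a:])) x = 0" "eval2 (pderiv B) x a = 0"
  shows "derivation x a l m n \<in> tangent_space V v"
proof -
  have B0: "eval2 B x a = 0" using on_surface[OF v(1)] v(2) by (simp add: x a)
  have nfv: "normal_form p q v = eval2 p x a" for p q using v by (simp add: normal_form_def x a)
  have pderiv_add': "pderiv (poly (p + q) [:a:]) = pderiv (poly p [:a:]) + pderiv (poly q [:a:])"
    for p q :: "complex poly poly" by (simp add: pderiv_add)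
  show ?thesis
    unfolding tangent_space_def
  proof (intro CollectI conjI allI ballI impI)
    fix f assume "f \<notin> regular V" then show "derivation x a l m n f = 0" by (simp add: derivation_def)
  next
    fix c f assume "f \<in> regular V"
    then obtain p q where f: "f = normal_form p q" by (auto simp: regular_eq_normal_form)
    show "derivation x a l m n (\<lambda>q. c * f q) = c * derivation x a l m n f"
      unfolding f normal_form_scale derivation_normal_form by (simp add: pderiv_smult algebra_simps eval2_def)
  next
    fix f g assume "f \<in> regular V" "g \<in> regular V"
    then obtain p q p' q' where f: "f = normal_form p q" "g = normal_form p' q'" by (auto simp: regular_eq_normal_form)
    show "derivation x a l m n (f + g) = derivation x a l m n f + derivation x a l m n g"
      unfolding f normal_form_add derivation_normal_form by (simp add: pderiv_add algebra_simps)
    show "derivation x a l m n (f * g) = f v * derivation x a l m n g + g v * derivation x a l m n f"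
      unfolding f normal_form_mult derivation_normal_form nfv using B0 sing
      by (simp add: pderiv_add pderiv_mult algebra_simps eval2_def)
  qed
qed

lemma derivation_vanishing_on_generators:
  assumes v: "v \<in> points V" and D: "D \<in> tangent_space V v"
    and gens: "D (normal_form [:[:0, 1:]:] 0) = 0" "D (normal_form [:0, 1:] 0) = 0" "D (normal_form 0 1) = 0"
  shows "D = 0"
proof -
  have scale: "D (\<lambda>w. c * f w) = c * D f"
    and add: "D (f + g) = D f + D g" and mult: "D (f * g) = f v * D g + g v * D f"
    and out: "f' \<notin> regular V \<Longrightarrow> D f' = 0"
    if "f \<in> regular V" "g \<in> regular V" for f g c f'
    using D that by (auto simp: tangent_space_def)
  have unit: "D (normal_form 1 0) = 0"
    using mult[of "normal_form 1 0" "normal_form 1 0"] v by (simp add: normal_form_mult) (simp add: normal_form_def)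
  have const: "D (normal_form [:[:c:]:] 0) = 0" for c
    using scale[of "normal_form 1 0" "normal_form 1 0" c] unit by (simp add: normal_form_scale)
  have step: "D (normal_form p q + normal_form p' q' * normal_form p'' q'') =
      D (normal_form p q) + (normal_form p' q' v * D (normal_form p'' q'') + normal_form p'' q'' v * D (normal_form p' q'))" for p q p' q' p'' q''
    by (simp only: add mult normal_form_regular normal_form_mult) (simp only: mult normal_form_regular flip: normal_form_mult)
  have px: "D (normal_form [:c:] 0) = 0" for c
  proof (induction c)
    case (pCons k c)
    have "normal_form [:pCons k c:] 0 = normal_form [:[:k:]:] 0 + normal_form [:[:0, 1:]:] 0 * normal_form [:c:] 0"
      unfolding normal_form_mult normal_form_add by simp
    then show ?case using pCons by (simp only: step const gens) simp
  qed (use const[of 0] in simp)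
  have pa: "D (normal_form p 0) = 0" for p
  proof (induction p)
    case (pCons k c)
    have "normal_form (pCons k c) 0 = normal_form [:k:] 0 + normal_form [:0, 1:] 0 * normal_form c 0"
      unfolding normal_form_mult normal_form_add by simp
    then show ?case using pCons by (simp only: step px gens) simp
  qed (use const[of 0] in simp)
  have "D (normal_form p q) = 0" for p q
  proof -
    have "normal_form p q = normal_form p 0 + normal_form 0 1 * normal_form q 0" unfolding normal_form_mult normal_form_add by simp
    then show ?thesis by (simp only: step pa gens) simp
  qed
  then have "D f = 0" for f using out[of "normal_form 0 0" "normal_form 0 0" f] by (cases "f \<in> regular V") (auto simp: regular_eq_normal_form)
  then show ?thesis by (auto simp: fun_eq_iff)
qed

text \<open>
  Above a singular point of the branch curve the tangent space has the dimension 3 of the ambient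
  space, whereas the surface has dimension at most 2.
\<close>

lemma singular_at_branch_singularity:
  assumes zero: "eval2 B x a = 0"
    and sing: "poly (pderiv (poly B [:a:])) x = 0" "eval2 (pderiv B) x a = 0"
  shows "singular V"
proof -
  obtain v where v: "v \<in> points V" "X v = x" "A v = a" "C v = 0"
    using covers[of 0 x a] zero by auto
  interpret F: vector_space "\<lambda>(c::complex) (D :: ('a \<Rightarrow> complex) \<Rightarrow> complex) f. c * D f"
    by (rule vector_space_complex_fun)
  define d where "d = derivation x a"
  have d: "d l m n \<in> tangent_space V v" for l m n
    unfolding d_def using v sing by (intro derivation_in_tangent_space) auto
  have gen: "d l m n (normal_form [:[:0, 1:]:] 0) = l" "d l m n (normal_form [:0, 1:] 0) = m" "d l m n (normal_form 0 1) = n"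
    for l m n
    by (simp_all add: d_def derivation_normal_form pderiv_pCons)
  have lin: "d l m n = (\<lambda>f. l * d 1 0 0 f) + (\<lambda>f. m * d 0 1 0 f) + (\<lambda>f. n * d 0 0 1 f)" for l m n
    by (auto simp: fun_eq_iff d_def derivation_def algebra_simps)
  let ?E = "{d 1 0 0, d 0 1 0, d 0 0 1}"
  have ne: "d 1 0 0 \<noteq> d 0 1 0" "d 1 0 0 \<noteq> d 0 0 1" "d 0 1 0 \<noteq> d 0 0 1"
    by (metis gen zero_neq_one)+
  have "F.dim (tangent_space V v) = 3"
  proof (rule F.dim_unique)
    show "?E \<subseteq> tangent_space V v" using d by auto
    show "tangent_space V v \<subseteq> F.span ?E"
    proof
      fix D assume D: "D \<in> tangent_space V v"
      define l m n where "l = D (normal_form [:[:0, 1:]:] 0)" and "m = D (normal_form [:0, 1:] 0)" and "n = D (normal_form 0 1)"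
      have "D - d l m n \<in> tangent_space V v"
        using D d[of l m n] unfolding tangent_space_def by (auto simp: algebra_simps)
      then have "D - d l m n = 0"
        by (rule derivation_vanishing_on_generators[OF v(1)]) (simp_all add: gen l_def m_def n_def)
      then have "D = d l m n" by simp
      also have "\<dots> \<in> F.span ?E"
        unfolding lin[of l m n] by (intro F.span_add F.span_scale F.span_base) auto
      finally show "D \<in> F.span ?E" .
    qed
    show "F.independent ?E"
    proof (rule ccontr)
      assume "\<not> F.independent ?E"
      then obtain c where nz: "\<exists>D\<in>?E. c D \<noteq> 0" and sum: "(\<Sum>D\<in>?E. (\<lambda>f. c D * D f)) = 0"
        using F.dependent_finite[of ?E] by auto
      have *: "c (d 1 0 0) * d 1 0 0 f + (c (d 0 1 0) * d 0 1 0 f + c (d 0 0 1) * d 0 0 1 f) = 0" for f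
        using fun_cong[OF sum, of f] ne by simp
      show False
        using nz *[of "normal_form [:[:0, 1:]:] 0"] *[of "normal_form [:0, 1:] 0"] *[of "normal_form 0 1"] by (auto simp: gen)
    qed
    show "card ?E = 3" unfolding card_3_iff using ne by blast
  qed
  then have "tangent_dim V v = 3" by (simp add: tangent_dim_def)
  moreover have "local_dim V v \<noteq> enat 3"
    using local_dim_le_2[of v] by (auto simp: numeral_eq_enat)
  ultimately show ?thesis using v by (auto simp: singular_def singular_point_def)
qed

end

section \<open>The invariants of the involution\<close>

text \<open>
  With \<open>s = 2y + x - t\<^sub>2/2\<close> and \<open>w = 2z\<close> the involution becomes \<open>(s, w) \<mapsto> (-s, -w)\<close>, with \<open>x\<close> and
  the parameters fixed, and the equation of the family becomes \<open>w\<^sup>2 = x s\<^sup>2 - P(x)\<close> for a monic cubic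
  polynomial \<open>P\<close> depending on the parameters (\<open>X_C3_iff\<close>).
\<close>

definition anti_y :: "C6 \<Rightarrow> complex" where
  "anti_y p = 2 * fst (snd p) + fst p - fst (alpha p) / 2"

definition anti_z :: "C6 \<Rightarrow> complex" where
  "anti_z p = 2 * fst (snd (snd p))"

lemma anti_sigma [simp]: "anti_y (sigma p) = - anti_y p" "anti_z (sigma p) = - anti_z p"
  by (cases p; simp add: anti_y_def anti_z_def alpha_eq field_simps)+

lemma fst_sigma [simp]: "fst (sigma p) = fst p"
  by (cases p) auto

definition invariants :: "C6 \<Rightarrow> C6" where
  "invariants p = (fst p, anti_y p ^ 2, anti_y p * anti_z p, alpha p)"

lemma invariants_sigma [simp]: "invariants (sigma p) = invariants p"
  by (simp add: invariants_def)

lemma fst_invariants [simp]: "fst (invariants p) = fst p"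
  by (simp add: invariants_def)

lemma alpha_invariants [simp]: "alpha (invariants p) = alpha p"
  by (simp add: invariants_def alpha_eq)

definition cubic :: "C3 \<Rightarrow> complex poly" where
  "cubic t = [: - (snd (snd t) + fst t * fst (snd t) / 6 + fst t ^ 3 / 108),
     fst (snd t) + fst t ^ 2 / 4, - fst t, 1 :]"

lemma X_C3_iff:
  "p \<in> points X_C3 \<longleftrightarrow> anti_z p ^ 2 = fst p * anti_y p ^ 2 - poly (cubic (alpha p)) (fst p)"
proof -
  obtain x y z t2 t4 t6 where p: "p = (x, y, z, t2, t4, t6)" by (cases p) auto
  let ?r = "x * y * (x + y) - 1/2 * t2 * x * y - 1/4 * t4 * x + 1/4 * (t6 + 1/6 * t2 * t4 + 1/108 * t2 ^ 3)"
  have "fst p * anti_y p ^ 2 - poly (cubic (alpha p)) (fst p) = 4 * ?r"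
    by (simp add: p anti_y_def cubic_def alpha_eq field_simps power2_eq_square power3_eq_cube)
  moreover have "anti_z p ^ 2 = 4 * z ^ 2" by (simp add: p anti_z_def power_mult_distrib)
  moreover have "p \<in> points X_C3 \<longleftrightarrow> 4 * z ^ 2 = 4 * ?r"
    by (simp only: p points_X_C3_iff mult_cancel_left) simp
  ultimately show ?thesis by (simp only:)
qed

text \<open>
  The invariants \<open>a = s\<^sup>2\<close> and \<open>c = s w\<close> satisfy \<open>c\<^sup>2 = a (a x - P(x))\<close>; the invariant
  \<open>w\<^sup>2 = a x - P(x)\<close> is redundant.
\<close>

definition branch :: "C3 \<Rightarrow> complex poly poly" where
  "branch t = [:0, - cubic t, [:0, 1:]:]"

lemma eval2_branch: "eval2 (branch t) x a = a * (a * x - poly (cubic t) x)"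
  by (simp add: branch_def algebra_simps)

lemma branch_nonzero: "branch t \<noteq> 0"
  by (simp add: branch_def)

abbreviation quot_coords :: "C6 set \<Rightarrow> C6" where
  "quot_coords \<equiv> induced_map invariants"

lemma quot_coords_orbit [simp]: "quot_coords (orbit Omega p) = invariants p"
  by (simp add: induced_map_def orbit_Omega)

lemma points_X_quot: "points X_quot = orbit Omega ` points X_C3"
  by (simp add: X_quot_def quotient_variety_def)

lemma alpha_quot_coords: "v \<in> points X_quot \<Longrightarrow> alpha_quot v = alpha (quot_coords v)"
  by (auto simp: points_X_quot)

lemma quot_coords_surface:
  assumes "v \<in> points X_quot" "quot_coords v = (x, a, c, t)"
  shows "c ^ 2 = eval2 (branch t) x a"
proof -
  obtain p where p: "p \<in> points X_C3" "v = orbit Omega p" using assms by (auto simp: points_X_quot)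
  have "(anti_y p * anti_z p) ^ 2 = anti_y p ^ 2 * (anti_y p ^ 2 * fst p - poly (cubic (alpha p)) (fst p))"
    using p(1) by (simp add: power_mult_distrib X_C3_iff mult.commute)
  then show ?thesis using assms(2) by (auto simp: p(2) invariants_def eval2_branch)
qed

lemma quot_coords_surj:
  assumes "c ^ 2 = eval2 (branch t) x a"
  shows "\<exists>v\<in>points X_quot. quot_coords v = (x, a, c, t)"
proof -
  define s where "s = csqrt a"
  have s: "s ^ 2 = a" by (simp add: s_def)
  \<comment> \<open>where \<open>s = 0\<close> the product \<open>c = s w\<close> does not determine \<open>w\<close>, but the equation does up to sign\<close>
  define w where "w = (if s = 0 then csqrt (- poly (cubic t) x) else c / s)"
  have sw: "s * w = c"
    using assms s by (auto simp: w_def eval2_branch)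
  have w: "w ^ 2 = x * s ^ 2 - poly (cubic t) x"
  proof (cases "s = 0")
    case False
    have "s ^ 2 * w ^ 2 = c ^ 2" by (simp only: sw flip: power_mult_distrib)
    also have "\<dots> = s ^ 2 * (x * s ^ 2 - poly (cubic t) x)"
      using assms s by (simp add: eval2_branch mult.commute)
    finally have "s ^ 2 * w ^ 2 = s ^ 2 * (x * s ^ 2 - poly (cubic t) x)" .
    with False show ?thesis by simp
  qed (simp add: w_def)
  define p :: C6 where "p = (x, (s - x + fst t / 2) / 2, w / 2, t)"
  have p: "anti_y p = s" "anti_z p = w" "fst p = x" "alpha p = t"
    by (simp_all add: p_def anti_y_def anti_z_def alpha_eq field_simps)
  then have "p \<in> points X_C3" using w by (simp add: X_C3_iff)
  then show ?thesis
    using p s sw by (intro bexI[of _ "orbit Omega p"]) (auto simp: points_X_quot invariants_def)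
qed

lemma quot_coords_inj:
  assumes "v \<in> points X_quot" "v' \<in> points X_quot" "quot_coords v = quot_coords v'"
  shows "v = v'"
proof -
  obtain p p' where p: "p \<in> points X_C3" "v = orbit Omega p" "p' \<in> points X_C3" "v' = orbit Omega p'"
    using assms by (auto simp: points_X_quot)
  have eq: "fst p = fst p'" "alpha p = alpha p'" "anti_y p ^ 2 = anti_y p' ^ 2"
    "anti_y p * anti_z p = anti_y p' * anti_z p'"
    using assms(3) by (simp_all add: p invariants_def)
  then have z2: "anti_z p ^ 2 = anti_z p' ^ 2" using p by (simp add: X_C3_iff)
  have same: "u = u'" if "fst u = fst u'" "alpha u = alpha u'" "anti_y u = anti_y u'" "anti_z u = anti_z u'"
    for u u' :: C6
    using that by (cases u; cases u') (auto simp: anti_y_def anti_z_def alpha_eq)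
  have "p = p' \<or> p = sigma p'"
  proof (cases "anti_y p = anti_y p' \<and> anti_z p = anti_z p'")
    case True then show ?thesis using eq same by blast
  next
    case False
    have y: "anti_y p = anti_y p' \<or> anti_y p = - anti_y p'"
      and z: "anti_z p = anti_z p' \<or> anti_z p = - anti_z p'"
      using eq(3) z2 by (simp_all add: power2_eq_iff)
    have "anti_y p = - anti_y p' \<and> anti_z p = - anti_z p'"
      using y z False eq(4) by (auto simp: eq_neg_iff_add_eq_0)
    then show ?thesis using eq same[of p "sigma p'"] by simp
  qed
  then show ?thesis by (auto simp: p)
qed

lemma regular_X_C3: "f \<in> regular X_C3 \<longleftrightarrow>
    (\<exists>g\<in>polynomial_functions coords6. f = (\<lambda>p. if p \<in> points X_C3 then g p else 0))"
  by (auto simp: X_C3_def subvariety_def affine6_def affine_space_def)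

lemma polynomial_invariants:
  assumes "f \<in> polynomial_functions coords6"
  shows "(\<lambda>p. f (invariants p)) \<in> polynomial_functions coords6"
  unfolding invariants_def anti_y_def anti_z_def
  by (rule polynomial_compose6[OF assms]) (intro polynomial_intros)+

text \<open>
  Over the invariants, the coordinate ring of the family is generated as a module by \<open>1, s, w\<close>,
  since \<open>s\<^sup>2\<close>, \<open>s w\<close> and \<open>w\<^sup>2\<close> are invariants. The involution negates \<open>s\<close> and \<open>w\<close>, so averaging
  leaves the first component; this is how the invariant functions are found in \<open>regular_X_quot\<close>.
\<close>

lemma invariant_decomposition:
  assumes "g \<in> polynomial_functions coords6"
  shows "\<exists>e0\<in>polynomial_functions coords6. \<exists>e1\<in>polynomial_functions coords6.
    \<exists>e2\<in>polynomial_functions coords6. \<forall>p\<in>points X_C3. g p =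
      e0 (invariants p) + anti_y p * e1 (invariants p) + anti_z p * e2 (invariants p)"
  using assms
proof induction
  case (const c)
  show ?case
    by (rule bexI[of _ "\<lambda>_. c"], rule bexI[of _ "\<lambda>_. 0"], rule bexI[of _ "\<lambda>_. 0"])
      (auto intro: polynomial_intros)
next
  case (coord f)
  then consider (inv) h where "h \<in> polynomial_functions coords6" "f = (\<lambda>p. h (invariants p))"
    | (y) "f = (\<lambda>p. fst (snd p))" | (z) "f = (\<lambda>p. fst (snd (snd p)))"
  proof -
    have "f \<in> {\<lambda>p. fst (snd p), \<lambda>p. fst (snd (snd p))} \<or>
      f \<in> {\<lambda>p. fst (invariants p), \<lambda>p. fst (alpha (invariants p)),
        \<lambda>p. fst (snd (alpha (invariants p))), \<lambda>p. snd (snd (alpha (invariants p)))}"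
      using coord by (auto simp: coords6_def case_prod_unfold alpha_eq invariants_def)
    then show ?thesis using that polynomial_coords6 by blast
  qed
  then show ?case
  proof cases
    case inv
    show ?thesis
      by (rule bexI[of _ h], rule bexI[of _ "\<lambda>_. 0"], rule bexI[of _ "\<lambda>_. 0"])
        (auto intro: polynomial_intros simp: inv)
  next
    case y
    show ?thesis
      by (rule bexI[of _ "\<lambda>p. fst (alpha p) / 4 - fst p / 2"], rule bexI[of _ "\<lambda>_. 1/2"],
          rule bexI[of _ "\<lambda>_. 0"])
        (auto intro!: polynomial_intros simp: y anti_y_def field_simps)
  next
    case z
    show ?thesis
      by (rule bexI[of _ "\<lambda>_. 0"], rule bexI[of _ "\<lambda>_. 0"], rule bexI[of _ "\<lambda>_. 1/2"])
        (auto intro!: polynomial_intros simp: z anti_z_def)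
  qed
next
  case (add f g)
  then obtain e0 e1 e2 h0 h1 h2 where
    e: "e0 \<in> polynomial_functions coords6" "e1 \<in> polynomial_functions coords6"
      "e2 \<in> polynomial_functions coords6" "h0 \<in> polynomial_functions coords6"
      "h1 \<in> polynomial_functions coords6" "h2 \<in> polynomial_functions coords6" and
    f: "\<And>p. p \<in> points X_C3 \<Longrightarrow> f p =
      e0 (invariants p) + anti_y p * e1 (invariants p) + anti_z p * e2 (invariants p)" and
    g: "\<And>p. p \<in> points X_C3 \<Longrightarrow> g p =
      h0 (invariants p) + anti_y p * h1 (invariants p) + anti_z p * h2 (invariants p)"
    by metis
  show ?case
    by (rule bexI[of _ "\<lambda>p. e0 p + h0 p"], rule bexI[of _ "\<lambda>p. e1 p + h1 p"],
        rule bexI[of _ "\<lambda>p. e2 p + h2 p"])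
      (auto intro!: polynomial_intros e simp: f g algebra_simps)
next
  case (mult f g)
  then obtain e0 e1 e2 h0 h1 h2 where
    e: "e0 \<in> polynomial_functions coords6" "e1 \<in> polynomial_functions coords6"
      "e2 \<in> polynomial_functions coords6" "h0 \<in> polynomial_functions coords6"
      "h1 \<in> polynomial_functions coords6" "h2 \<in> polynomial_functions coords6" and
    f: "\<And>p. p \<in> points X_C3 \<Longrightarrow> f p =
      e0 (invariants p) + anti_y p * e1 (invariants p) + anti_z p * e2 (invariants p)" and
    g: "\<And>p. p \<in> points X_C3 \<Longrightarrow> g p =
      h0 (invariants p) + anti_y p * h1 (invariants p) + anti_z p * h2 (invariants p)"
    by metis
  \<comment> \<open>the invariant \<open>w\<^sup>2\<close> in terms of the other invariants\<close>
  define k :: "C6 \<Rightarrow> complex" where "k p = fst p * fst (snd p) - poly (cubic (alpha p)) (fst p)" for p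
  have k: "k \<in> polynomial_functions coords6"
    unfolding k_def cubic_def by (simp, intro polynomial_intros)
  have kz: "anti_z p * anti_z p = k (invariants p)" if "p \<in> points X_C3" for p
    using that by (simp add: X_C3_iff k_def power2_eq_square) (simp add: invariants_def power2_eq_square)
  have yy: "anti_y p * anti_y p = fst (snd (invariants p))"
    and yz: "anti_y p * anti_z p = fst (snd (snd (invariants p)))" for p
    by (simp_all add: invariants_def power2_eq_square)
  have expand: "(a + y * b + z * c) * (a' + y * b' + z * c') =
      (a * a' + y * y * (b * b') + z * z * (c * c') + y * z * (b * c' + c * b'))
      + y * (a * b' + b * a') + z * (a * c' + c * a')" for a b c a' b' c' y z :: complex
    by (simp add: algebra_simps)
  show ?case
    by (rule bexI[of _ "\<lambda>p. e0 p * h0 p + fst (snd p) * (e1 p * h1 p) + k p * (e2 p * h2 p)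
          + fst (snd (snd p)) * (e1 p * h2 p + e2 p * h1 p)"],
        rule bexI[of _ "\<lambda>p. e0 p * h1 p + e1 p * h0 p"],
        rule bexI[of _ "\<lambda>p. e0 p * h2 p + e2 p * h0 p"])
      (auto intro!: polynomial_intros e k simp: f g expand kz yy yz)
qed

lemma regular_X_quot: "F \<in> regular X_quot \<longleftrightarrow> (\<exists>G\<in>polynomial_functions coords6.
    F = (\<lambda>v. if v \<in> points X_quot then G (quot_coords v) else 0))"
proof
  assume "F \<in> regular X_quot"
  then have F: "\<And>v. v \<notin> points X_quot \<Longrightarrow> F v = 0" "pullback X_C3 (orbit Omega) F \<in> regular X_C3"
    by (auto simp: X_quot_def quotient_variety_def)
  then obtain g where g: "g \<in> polynomial_functions coords6"
    and "pullback X_C3 (orbit Omega) F = (\<lambda>p. if p \<in> points X_C3 then g p else 0)"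
    by (auto simp: regular_X_C3)
  then have Fg: "F (orbit Omega p) = g p" if "p \<in> points X_C3" for p
    using that by (metis pullback_def)
  obtain e0 e1 e2 where e0: "e0 \<in> polynomial_functions coords6" and
    e: "\<And>p. p \<in> points X_C3 \<Longrightarrow> g p =
      e0 (invariants p) + anti_y p * e1 (invariants p) + anti_z p * e2 (invariants p)"
    using invariant_decomposition[OF g] by metis
  have "F (orbit Omega p) = e0 (invariants p)" if p: "p \<in> points X_C3" for p
  proof -
    have "2 * F (orbit Omega p) = g p + g (sigma p)"
      using Fg[of p] Fg[of "sigma p"] p by simp
    also have "\<dots> = 2 * e0 (invariants p)" using e[of p] e[of "sigma p"] p by simp
    finally show ?thesis by simp
  qed
  then have "F = (\<lambda>v. if v \<in> points X_quot then e0 (quot_coords v) else 0)"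
    using F(1) by (auto simp: fun_eq_iff points_X_quot)
  then show "\<exists>G\<in>polynomial_functions coords6.
    F = (\<lambda>v. if v \<in> points X_quot then G (quot_coords v) else 0)" using e0 by blast
next
  assume "\<exists>G\<in>polynomial_functions coords6.
    F = (\<lambda>v. if v \<in> points X_quot then G (quot_coords v) else 0)"
  then obtain G where G: "G \<in> polynomial_functions coords6"
    and F: "F = (\<lambda>v. if v \<in> points X_quot then G (quot_coords v) else 0)" by blast
  have "pullback X_C3 (orbit Omega) F = (\<lambda>p. if p \<in> points X_C3 then G (invariants p) else 0)"
    by (auto simp: pullback_def F points_X_quot)
  then have "pullback X_C3 (orbit Omega) F \<in> regular X_C3"
    using polynomial_invariants[OF G] by (auto simp: regular_X_C3)
  then show "F \<in> regular X_quot"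
    by (auto simp: X_quot_def quotient_variety_def F)
qed

lemma points_fibre: "v \<in> points (fibre X_quot alpha_quot t) \<longleftrightarrow> v \<in> points X_quot \<and> alpha_quot v = t"
  by (auto simp: fibre_def subvariety_def)

lemma regular_fibre: "f \<in> regular (fibre X_quot alpha_quot t) \<longleftrightarrow> (\<exists>G\<in>polynomial_functions coords6.
    f = (\<lambda>v. if v \<in> points (fibre X_quot alpha_quot t) then G (quot_coords v) else 0))"
proof -
  let ?r = "\<lambda>H v. if v \<in> points (fibre X_quot alpha_quot t) then H v else 0"
  have r: "?r (\<lambda>v. if v \<in> points X_quot then G (quot_coords v) else 0) = ?r (\<lambda>v. G (quot_coords v))" for G
    by (auto simp: points_fibre)
  have "f \<in> regular (fibre X_quot alpha_quot t) \<longleftrightarrow> (\<exists>H\<in>regular X_quot. f = ?r H)"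
    by (auto simp: fibre_def subvariety_def)
  also have "\<dots> \<longleftrightarrow> (\<exists>G\<in>polynomial_functions coords6. f = ?r (\<lambda>v. G (quot_coords v)))"
    unfolding r[symmetric] Bex_def regular_X_quot by blast
  finally show ?thesis .
qed

section \<open>Normal forms in families\<close>

text \<open>
  Families of bivariate polynomials over the parameter space: elements of \<open>\<complex>[t\<^sub>2, t\<^sub>4, t\<^sub>6][x, a]\<close>, given
  by their specialisations.
\<close>

definition poly_family :: "(C3 \<Rightarrow> complex poly poly) \<Rightarrow> bool" where
  "poly_family p \<longleftrightarrow> (\<exists>d. \<forall>t. bidegree_le d (p t)) \<and>
    (\<forall>i j. (\<lambda>t. coeff (coeff (p t) j) i) \<in> polynomial_functions coords3)"

lemma poly_family_const: "poly_family (\<lambda>_. p)"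
  using bidegree_le_exists by (auto simp: poly_family_def intro: polynomial_intros)

lemma poly_family_add:
  assumes "poly_family p" "poly_family q" shows "poly_family (\<lambda>t. p t + q t)"
proof -
  obtain d e where "\<forall>t. bidegree_le d (p t)" "\<forall>t. bidegree_le e (q t)"
    using assms by (auto simp: poly_family_def)
  then have "\<forall>t. bidegree_le (max d e) (p t + q t)"
    by (meson bidegree_le_add bidegree_le_mono max.cobounded1 max.cobounded2)
  then show ?thesis
    using assms by (auto simp: poly_family_def intro: polynomial_intros)
qed

lemma poly_family_mult:
  assumes "poly_family p" "poly_family q" shows "poly_family (\<lambda>t. p t * q t)"
proof -
  obtain d e where "\<forall>t. bidegree_le d (p t)" "\<forall>t. bidegree_le e (q t)"
    using assms by (auto simp: poly_family_def)
  then have "\<forall>t. bidegree_le (d + e) (p t * q t)" by (auto intro: bidegree_le_mult)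
  moreover have "(\<lambda>t. coeff (coeff (p t * q t) j) i) \<in> polynomial_functions coords3" for i j
    using assms unfolding coeff_mult coeff_sum
    by (intro polynomial_intros) (auto simp: poly_family_def)
  ultimately show ?thesis by (auto simp: poly_family_def)
qed

lemma poly_family_scalar:
  assumes "h \<in> polynomial_functions coords3" shows "poly_family (\<lambda>t. [:[:h t:]:])"
  unfolding poly_family_def
proof (intro conjI allI exI)
  show "bidegree_le 0 [:[:h t:]:]" for t
    by (auto simp: bidegree_le_def coeff_pCons split: nat.split)
  show "(\<lambda>t. coeff (coeff [:[:h t:]:] j) i) \<in> polynomial_functions coords3" for i j
    using assms by (cases i; cases j) (auto intro: polynomial_intros)
qed

lemma poly_family_branch: "poly_family branch"
proof -
  have X: "poly_family (\<lambda>_. [:[:0, 1:]:])" and A: "poly_family (\<lambda>_. [:0, 1:])"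
    by (rule poly_family_const)+
  have "branch t = [:0, 1:] * ([:[:snd (snd t) + fst t * fst (snd t) / 6 + fst t ^ 3 / 108:]:]
      + [:[:- (fst (snd t) + fst t ^ 2 / 4):]:] * [:[:0, 1:]:]
      + [:[:fst t:]:] * ([:[:0, 1:]:] * [:[:0, 1:]:])
      + [:[:-1:]:] * ([:[:0, 1:]:] * ([:[:0, 1:]:] * [:[:0, 1:]:]))
      + [:0, 1:] * [:[:0, 1:]:])" for t
    by (simp add: branch_def cubic_def)
  moreover have "poly_family (\<lambda>t. [:0, 1:] * ([:[:snd (snd t) + fst t * fst (snd t) / 6 + fst t ^ 3 / 108:]:]
      + [:[:- (fst (snd t) + fst t ^ 2 / 4):]:] * [:[:0, 1:]:]
      + [:[:fst t:]:] * ([:[:0, 1:]:] * [:[:0, 1:]:])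
      + [:[:-1:]:] * ([:[:0, 1:]:] * ([:[:0, 1:]:] * [:[:0, 1:]:]))
      + [:0, 1:] * [:[:0, 1:]:]))"
    by (intro poly_family_add poly_family_mult poly_family_scalar X A polynomial_intros)
  ultimately show ?thesis by (simp add: fun_eq_iff[symmetric]) presburger
qed

text \<open>
  The elimination of \<open>c\<^sup>2\<close> carried out with coefficients depending polynomially on the parameters.
  Specialising the parameters gives the normal forms of a fibre (\<open>fibre_double_plane\<close>); the
  dependence on the parameters gives flatness (\<open>basis_expand\<close>).
\<close>

lemma family_normal_form:
  assumes "G \<in> polynomial_functions coords6"
  shows "\<exists>p q. poly_family p \<and> poly_family q \<and> (\<forall>x a c t. c ^ 2 = eval2 (branch t) x a \<longrightarrow>
    G (x, a, c, t) = eval2 (p t) x a + c * eval2 (q t) x a)"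
  using assms
proof induction
  case (const c)
  show ?case
    by (rule exI[of _ "\<lambda>_. [:[:c:]:]"], rule exI[of _ "\<lambda>_. 0"]) (simp add: poly_family_const)
next
  case (coord f)
  then consider (x) "f = (\<lambda>(x, a, c, t). x)" | (a) "f = (\<lambda>(x, a, c, t). a)" | (c) "f = (\<lambda>(x, a, c, t). c)"
    | (t) h where "h \<in> polynomial_functions coords3" "f = (\<lambda>(x, a, c, t). h t)"
  proof -
    have "\<exists>h\<in>polynomial_functions coords3. (\<lambda>(x, y, z, t2, t4, t6). t2) = (\<lambda>(x, a, c, t). h t :: complex)"
      "\<exists>h\<in>polynomial_functions coords3. (\<lambda>(x, y, z, t2, t4, t6). t4) = (\<lambda>(x, a, c, t). h t :: complex)"
      "\<exists>h\<in>polynomial_functions coords3. (\<lambda>(x, y, z, t2, t4, t6). t6) = (\<lambda>(x, a, c, t). h t :: complex)"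
      by (rule bexI[OF _ polynomial_coords3(1)] bexI[OF _ polynomial_coords3(2)]
          bexI[OF _ polynomial_coords3(3)]; auto simp: fun_eq_iff; fail)+
    then show ?thesis
      using coord that unfolding coords6_def by (auto simp: case_prod_unfold)
  qed
  then show ?case
  proof cases
    case x
    show ?thesis
      by (rule exI[of _ "\<lambda>_. [:[:0, 1:]:]"], rule exI[of _ "\<lambda>_. 0"]) (simp add: x poly_family_const)
  next
    case a
    show ?thesis
      by (rule exI[of _ "\<lambda>_. [:0, 1:]"], rule exI[of _ "\<lambda>_. 0"]) (simp add: a poly_family_const)
  next
    case c
    show ?thesis
      by (rule exI[of _ "\<lambda>_. 0"], rule exI[of _ "\<lambda>_. 1"]) (simp add: c poly_family_const)
  next
    case t
    show ?thesis
      by (rule exI[of _ "\<lambda>t. [:[:h t:]:]"], rule exI[of _ "\<lambda>_. 0"])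
        (simp add: t poly_family_const poly_family_scalar)
  qed
next
  case (add f g)
  then obtain p q p' q' where pq: "poly_family p" "poly_family q" "poly_family p'" "poly_family q'"
    and eq: "\<And>x a c t. c ^ 2 = eval2 (branch t) x a \<Longrightarrow> f (x, a, c, t) = eval2 (p t) x a + c * eval2 (q t) x a"
      "\<And>x a c t. c ^ 2 = eval2 (branch t) x a \<Longrightarrow> g (x, a, c, t) = eval2 (p' t) x a + c * eval2 (q' t) x a"
    by metis
  show ?case
    by (rule exI[of _ "\<lambda>t. p t + p' t"], rule exI[of _ "\<lambda>t. q t + q' t"])
      (simp add: pq poly_family_add eq algebra_simps)
next
  case (mult f g)
  then obtain p q p' q' where pq: "poly_family p" "poly_family q" "poly_family p'" "poly_family q'"
    and eq: "\<And>x a c t. c ^ 2 = eval2 (branch t) x a \<Longrightarrow> f (x, a, c, t) = eval2 (p t) x a + c * eval2 (q t) x a"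
      "\<And>x a c t. c ^ 2 = eval2 (branch t) x a \<Longrightarrow> g (x, a, c, t) = eval2 (p' t) x a + c * eval2 (q' t) x a"
    by metis
  show ?case
  proof (rule exI[of _ "\<lambda>t. p t * p' t + branch t * q t * q' t"],
      rule exI[of _ "\<lambda>t. p t * q' t + q t * p' t"], intro conjI allI impI)
    fix x a c t assume c: "c ^ 2 = eval2 (branch t) x a"
    show "(f * g) (x, a, c, t) = eval2 (p t * p' t + branch t * q t * q' t) x a
        + c * eval2 (p t * q' t + q t * p' t) x a"
      by (simp add: eq[OF c] flip: c) (simp add: algebra_simps power2_eq_square)
  qed (intro poly_family_add poly_family_mult poly_family_branch pq)+
qed

lemma polynomial_eval2:
  "(\<lambda>v. eval2 p (fst v) (fst (snd v))) \<in> polynomial_functions coords6"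
proof -
  obtain d where "bidegree_le d p" using bidegree_le_exists by blast
  then show ?thesis unfolding eval2_expand[OF \<open>bidegree_le d p\<close>] by (intro polynomial_intros)
qed

lemma fibre_double_plane: "double_plane (fibre X_quot alpha_quot t)
    (\<lambda>v. fst (quot_coords v)) (\<lambda>v. fst (snd (quot_coords v))) (\<lambda>v. fst (snd (snd (quot_coords v))))
    (branch t)"
proof
  show "branch t \<noteq> 0" by (rule branch_nonzero)
  have co: "quot_coords v = (fst (quot_coords v), fst (snd (quot_coords v)), fst (snd (snd (quot_coords v))), t)"
    if "v \<in> points (fibre X_quot alpha_quot t)" for v
    using that by (auto simp: points_fibre alpha_quot_coords alpha_eq)
  show surf: "fst (snd (snd (quot_coords v))) ^ 2 = eval2 (branch t) (fst (quot_coords v)) (fst (snd (quot_coords v)))"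
    if "v \<in> points (fibre X_quot alpha_quot t)" for v
    using quot_coords_surface[OF _ co[OF that]] that by (simp add: points_fibre)
  show "\<exists>v\<in>points (fibre X_quot alpha_quot t). fst (quot_coords v) = x \<and>
      fst (snd (quot_coords v)) = a \<and> fst (snd (snd (quot_coords v))) = c"
    if "c ^ 2 = eval2 (branch t) x a" for c x a
  proof -
    obtain v where "v \<in> points X_quot" "quot_coords v = (x, a, c, t)"
      using quot_coords_surj[OF \<open>c ^ 2 = _\<close>] by blast
    then show ?thesis
      by (intro bexI[of _ v]) (auto simp: points_fibre alpha_quot_coords alpha_eq)
  qed
  show "f \<in> regular (fibre X_quot alpha_quot t) \<longleftrightarrow> (\<exists>p q. f =
      (\<lambda>v. if v \<in> points (fibre X_quot alpha_quot t)
        then eval2 p (fst (quot_coords v)) (fst (snd (quot_coords v)))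
          + fst (snd (snd (quot_coords v))) * eval2 q (fst (quot_coords v)) (fst (snd (quot_coords v)))
        else 0))" (is "_ \<longleftrightarrow> ?R") for f
  proof
    assume "f \<in> regular (fibre X_quot alpha_quot t)"
    then obtain G where G: "G \<in> polynomial_functions coords6"
      and f: "f = (\<lambda>v. if v \<in> points (fibre X_quot alpha_quot t) then G (quot_coords v) else 0)"
      by (auto simp: regular_fibre)
    obtain p q where pq: "\<And>x a c t. c ^ 2 = eval2 (branch t) x a \<Longrightarrow>
        G (x, a, c, t) = eval2 (p t) x a + c * eval2 (q t) x a"
      using family_normal_form[OF G] by metis
    have "G (quot_coords v) = eval2 (p t) (fst (quot_coords v)) (fst (snd (quot_coords v)))
          + fst (snd (snd (quot_coords v))) * eval2 (q t) (fst (quot_coords v)) (fst (snd (quot_coords v)))"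
      if "v \<in> points (fibre X_quot alpha_quot t)" for v
      by (subst co[OF that]) (rule pq[OF surf[OF that]])
    then show ?R unfolding f by (intro exI[of _ "p t"] exI[of _ "q t"] ext) simp
  next
    assume ?R
    then obtain p q where f: "f = (\<lambda>v. if v \<in> points (fibre X_quot alpha_quot t)
        then eval2 p (fst (quot_coords v)) (fst (snd (quot_coords v)))
          + fst (snd (snd (quot_coords v))) * eval2 q (fst (quot_coords v)) (fst (snd (quot_coords v)))
        else 0)" by blast
    have "(\<lambda>v. eval2 p (fst v) (fst (snd v)) + fst (snd (snd v)) * eval2 q (fst v) (fst (snd v)))
        \<in> polynomial_functions coords6"
      by (intro polynomial_add polynomial_mult polynomial_eval2 polynomial_coords6)
    then show "f \<in> regular (fibre X_quot alpha_quot t)"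
      unfolding regular_fibre f by (rule bexI[rotated]) (rule refl)
  qed
qed

lemma cubic_root: "\<exists>x. poly (cubic t) x = 0"
  by (rule fundamental_theorem_of_algebra) (simp add: cubic_def constant_degree)

text \<open>
  At a root \<open>x\<close> of the cubic \<open>P\<close> the two components \<open>a = 0\<close> and \<open>a x = P(x)\<close> of the branch curve meet
  in \<open>(x, 0)\<close>, which is therefore a singular point of it. It lies below a fixed point of the
  involution.
\<close>

lemma fibre_singular: "singular (fibre X_quot alpha_quot t)"
proof -
  obtain x where "poly (cubic t) x = 0" using cubic_root by blast
  then show ?thesis
    by (intro double_plane.singular_at_branch_singularity[OF fibre_double_plane, of t x 0])
      (simp_all add: branch_def pderiv_pCons eval2_def)
qed

section \<open>Flatness and reducedness from a basis\<close>

text \<open>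
  A family of functions that generates the coordinate ring over the base and is linearly
  independent on every single fibre is a basis of it as a module over the base. A relation then
  holds coefficientwise, which is the equational criterion for flatness; and a function that
  vanishes on a fibre has coefficients that vanish at the base point.
\<close>

lemma flat_and_reduced_of_fibrewise_basis:
  fixes e :: "'l \<Rightarrow> 'a \<Rightarrow> complex"
  assumes reg: "\<And>l. e l \<in> regular V"
    and expand: "\<And>f. f \<in> regular V \<Longrightarrow> \<exists>S \<kappa>. finite S \<and> (\<forall>l. \<kappa> l \<in> regular W) \<and>
      (\<forall>l. l \<notin> S \<longrightarrow> \<kappa> l = 0) \<and> f = (\<Sum>l\<in>S. pullback V \<phi> (\<kappa> l) * e l)"
    and indep: "\<And>s S c. finite S \<Longrightarrow>
      (\<And>v. v \<in> points V \<Longrightarrow> \<phi> v = s \<Longrightarrow> (\<Sum>l\<in>S. c l * e l v) = 0) \<Longrightarrow> \<forall>l\<in>S. c l = 0"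
  shows "flat V W \<phi>" and "reduced_fibre V W \<phi> s"
proof -
  have enum: "\<exists>(k::nat) h. bij_betw h {..<k} S" if "finite S" for S :: "'l set"
    using ex_bij_betw_nat_finite[OF that] by (auto simp: atLeast0LessThan)
  show "flat V W \<phi>"
    unfolding flat_def
  proof (intro allI impI, elim conjE)
    fix n :: nat and a m
    assume am: "\<forall>i<n. a i \<in> regular W \<and> m i \<in> regular V"
      and rel: "(\<Sum>i<n. pullback V \<phi> (a i) * m i) = 0"
    define P where "P i S \<kappa> \<longleftrightarrow> finite S \<and> (\<forall>l. \<kappa> l \<in> regular W) \<and>
      (\<forall>l. l \<notin> S \<longrightarrow> \<kappa> l = 0) \<and> m i = (\<Sum>l\<in>S. pullback V \<phi> (\<kappa> l) * e l)" for i S \<kappa>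
    have "\<exists>S \<kappa>. P i S \<kappa>" if "i < n" for i
      unfolding P_def using am that by (intro expand) simp
    then obtain S \<kappa> where "\<And>i. i < n \<Longrightarrow> P i (S i) (\<kappa> i)" by metis
    then have S: "\<And>i. i < n \<Longrightarrow> finite (S i)" "\<And>i l. i < n \<Longrightarrow> \<kappa> i l \<in> regular W"
      "\<And>i l. i < n \<Longrightarrow> l \<notin> S i \<Longrightarrow> \<kappa> i l = 0"
      "\<And>i. i < n \<Longrightarrow> m i = (\<Sum>l\<in>S i. pullback V \<phi> (\<kappa> i l) * e l)"
      unfolding P_def by blast+
    define T where "T = (\<Union>i<n. S i)"
    have T: "finite T" using S(1) by (auto simp: T_def)
    have mT: "m i = (\<Sum>l\<in>T. pullback V \<phi> (\<kappa> i l) * e l)" if "i < n" for i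
      unfolding S(4)[OF that] using T that S(3)[OF that]
      by (intro sum.mono_neutral_left) (auto simp: T_def pullback_def fun_eq_iff)
    have zero: "(\<Sum>i<n. a i * \<kappa> i l) = 0" if "l \<in> T" for l
    proof
      fix s
      define c where "c l = (\<Sum>i<n. a i s * \<kappa> i l s)" for l
      have "(\<Sum>l\<in>T. c l * e l v) = 0" if v: "v \<in> points V" "\<phi> v = s" for v
      proof -
        have "(\<Sum>l\<in>T. c l * e l v) = (\<Sum>i<n. a i s * (\<Sum>l\<in>T. \<kappa> i l s * e l v))"
          unfolding c_def sum_distrib_right sum_distrib_left by (subst sum.swap) (simp add: mult.assoc)
        also have "\<dots> = (\<Sum>i<n. pullback V \<phi> (a i) * m i) v"
          using v by (simp add: mT pullback_def)
        finally show ?thesis by (simp add: rel)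
      qed
      then have "\<forall>l\<in>T. c l = 0" by (rule indep[OF T])
      then show "(\<Sum>i<n. a i * \<kappa> i l) s = 0 s" using that by (simp add: c_def)
    qed
    obtain k :: nat and h where h: "bij_betw h {..<k} T" using enum[OF T] by blast
    show "\<exists>(k::nat) b y. (\<forall>j<k. y j \<in> regular V) \<and> (\<forall>i<n. \<forall>j<k. b i j \<in> regular W) \<and>
        (\<forall>i<n. m i = (\<Sum>j<k. pullback V \<phi> (b i j) * y j)) \<and> (\<forall>j<k. (\<Sum>i<n. a i * b i j) = 0)"
    proof (intro exI[of _ k] exI[of _ "\<lambda>i j. \<kappa> i (h j)"] exI[of _ "\<lambda>j. e (h j)"] conjI allI impI)
      fix i assume i: "i < n"
      show "m i = (\<Sum>j<k. pullback V \<phi> (\<kappa> i (h j)) * e (h j))"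
        using sum.reindex_bij_betw[OF h, of "\<lambda>l. pullback V \<phi> (\<kappa> i l) * e l"] by (simp add: mT[OF i])
    qed (use h reg S(2) zero in \<open>auto simp: bij_betw_def\<close>)
  qed
  show "reduced_fibre V W \<phi> s"
    unfolding reduced_fibre_def
  proof (intro ballI impI)
    fix f assume f: "f \<in> regular V" and van: "\<forall>p\<in>points (fibre V \<phi> s). f p = 0"
    obtain S \<kappa> where S: "finite S" "\<And>l. \<kappa> l \<in> regular W" "f = (\<Sum>l\<in>S. pullback V \<phi> (\<kappa> l) * e l)"
      using expand[OF f] by blast
    have "(\<Sum>l\<in>S. \<kappa> l s * e l v) = 0" if v: "v \<in> points V" "\<phi> v = s" for v
    proof -
      have "f v = 0" using van v by (auto simp: fibre_def subvariety_def)
      then show ?thesis using v by (simp add: S(3) pullback_def)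
    qed
    then have zero: "\<forall>l\<in>S. \<kappa> l s = 0" by (rule indep[OF S(1)])
    obtain k :: nat and h where h: "bij_betw h {..<k} S" using enum[OF S(1)] by blast
    show "\<exists>(n::nat) a g. (\<forall>i<n. a i \<in> regular W \<and> a i s = 0 \<and> g i \<in> regular V) \<and>
        f = (\<Sum>i<n. pullback V \<phi> (a i) * g i)"
    proof (intro exI[of _ k] exI[of _ "\<lambda>j. \<kappa> (h j)"] exI[of _ "\<lambda>j. e (h j)"] conjI)
      show "f = (\<Sum>j<k. pullback V \<phi> (\<kappa> (h j)) * e (h j))"
        unfolding S(3) by (rule sum.reindex_bij_betw[OF h, symmetric])
    qed (use h reg S(2) zero in \<open>auto simp: bij_betw_def\<close>)
  qed
qed

text \<open>
  The monomials \<open>x\<^sup>i a\<^sup>j\<close> and \<open>x\<^sup>i a\<^sup>j c\<close>.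
\<close>

definition basis :: "nat \<times> nat \<times> bool \<Rightarrow> C6 set \<Rightarrow> complex" where
  "basis = (\<lambda>(i, j, b) v. if v \<in> points X_quot then
     fst (quot_coords v) ^ i * fst (snd (quot_coords v)) ^ j *
     (if b then fst (snd (snd (quot_coords v))) else 1) else 0)"

lemma basis_regular: "basis l \<in> regular X_quot"
proof -
  obtain i j b where l: "l = (i, j, b)" by (cases l) auto
  have "(\<lambda>p. fst p ^ i * fst (snd p) ^ j * (if b then fst (snd (snd p)) else 1))
      \<in> polynomial_functions coords6"
    by (cases b) (simp; intro polynomial_intros)+
  then show ?thesis unfolding regular_X_quot l basis_def by (auto intro!: bexI[rotated])
qed

lemma basis_expand:
  assumes "f \<in> regular X_quot"
  shows "\<exists>S \<kappa>. finite S \<and> (\<forall>l. \<kappa> l \<in> regular affine3) \<and> (\<forall>l. l \<notin> S \<longrightarrow> \<kappa> l = 0) \<and>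
    f = (\<Sum>l\<in>S. pullback X_quot alpha_quot (\<kappa> l) * basis l)"
proof -
  obtain G where G: "G \<in> polynomial_functions coords6"
    and f: "f = (\<lambda>v. if v \<in> points X_quot then G (quot_coords v) else 0)"
    using assms by (auto simp: regular_X_quot)
  obtain p q where pf: "poly_family p" "poly_family q" and
    normal_form: "\<And>x a c t. c ^ 2 = eval2 (branch t) x a \<Longrightarrow> G (x, a, c, t) = eval2 (p t) x a + c * eval2 (q t) x a"
    using family_normal_form[OF G] by metis
  obtain d1 d2 where "\<And>t. bidegree_le d1 (p t)" "\<And>t. bidegree_le d2 (q t)"
    using pf by (auto simp: poly_family_def)
  then have d: "bidegree_le (max d1 d2) (p t)" "bidegree_le (max d1 d2) (q t)" for t
    by (meson bidegree_le_mono max.cobounded1 max.cobounded2)+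
  define D where "D = {..max d1 d2}"
  define S where "S = D \<times> D \<times> (UNIV :: bool set)"
  define \<kappa> where "\<kappa> = (\<lambda>(i, j, b). if (i, j, b) \<in> S
    then \<lambda>t. coeff (coeff ((if b then q else p) t) j) i else 0)"
  have "\<kappa> l \<in> regular affine3" for l
  proof -
    have "0 \<in> polynomial_functions coords3" using polynomial_const[of 0 coords3] by (simp add: zero_fun_def)
    then show ?thesis
      using pf by (cases l) (auto simp: \<kappa>_def regular_affine3 poly_family_def)
  qed
  moreover have "\<kappa> l = 0" if "l \<notin> S" for l using that by (cases l) (auto simp: \<kappa>_def)
  moreover have "f v = (\<Sum>l\<in>S. pullback X_quot alpha_quot (\<kappa> l) * basis l) v" for v
  proof (cases "v \<in> points X_quot")
    case True
    obtain x a c t where v: "quot_coords v = (x, a, c, t)" by (cases "quot_coords v") auto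
    have t: "alpha_quot v = t" using True v by (simp add: alpha_quot_coords alpha_eq)
    have "f v = eval2 (p t) x a + c * eval2 (q t) x a"
      using normal_form[OF quot_coords_surface[OF True v]] True v by (simp add: f)
    also have "\<dots> = (\<Sum>i\<in>D. \<Sum>j\<in>D. coeff (coeff (p t) j) i * (x ^ i * a ^ j)
        + c * (coeff (coeff (q t) j) i * (x ^ i * a ^ j)))"
      by (simp add: eval2_expand[OF d(1)] eval2_expand[OF d(2)] D_def sum.distrib sum_distrib_left)
    also have "\<dots> = (\<Sum>i\<in>D. \<Sum>j\<in>D. \<Sum>b\<in>UNIV. \<kappa> (i, j, b) t * basis (i, j, b) v)"
      using True by (intro sum.cong) (simp_all add: UNIV_bool \<kappa>_def S_def basis_def v algebra_simps)
    also have "\<dots> = (\<Sum>l\<in>S. \<kappa> l t * basis l v)"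
      by (simp add: S_def sum.cartesian_product case_prod_unfold)
    finally show ?thesis using True by (simp add: pullback_def t)
  qed (simp add: f basis_def case_prod_unfold)
  ultimately show ?thesis
    by (intro exI[of _ S] exI[of _ \<kappa>]) (auto simp: S_def D_def)
qed

lemma basis_independent:
  assumes S: "finite S"
    and zero: "\<And>v. v \<in> points X_quot \<Longrightarrow> alpha_quot v = t \<Longrightarrow> (\<Sum>l\<in>S. c l * basis l v) = 0"
  shows "\<forall>l\<in>S. c l = 0"
proof -
  define part where "part b0 = (\<Sum>(i, j, b)\<in>S. if b = b0 then monom (monom (c (i, j, b)) i) j else 0)" for b0
  have "part False = 0 \<and> part True = 0"
  proof (rule double_plane.normal_form_unique[OF fibre_double_plane[of t]])
    fix v assume "v \<in> points (fibre X_quot alpha_quot t)"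
    then have v: "v \<in> points X_quot" "alpha_quot v = t" by (auto simp: points_fibre)
    let ?x = "fst (quot_coords v)" and ?a = "fst (snd (quot_coords v))" and ?c = "fst (snd (snd (quot_coords v)))"
    have "eval2 (part False) ?x ?a + ?c * eval2 (part True) ?x ?a = (\<Sum>l\<in>S. c l * basis l v)"
      using v(1)
      by (auto simp: part_def sum_distrib_left basis_def case_prod_unfold algebra_simps
          simp flip: sum.distrib intro!: sum.cong)
    then show "eval2 (part False) ?x ?a + ?c * eval2 (part True) ?x ?a = 0" using zero[OF v] by simp
  qed
  then have part: "part b = 0" for b by (cases b) auto
  show ?thesis
  proof
    fix l assume l: "l \<in> S"
    obtain i j b where ijb: "l = (i, j, b)" by (cases l) auto
    have "0 = coeff (coeff (part b) j) i" by (simp add: part)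
    also have "\<dots> = (\<Sum>k\<in>S. if k = l then c l else 0)"
    proof -
      have "coeff (coeff (case k of (i, j, b') \<Rightarrow> if b' = b then monom (monom (c (i, j, b')) i) j else 0) j) i
          = (if k = l then c l else 0)" for k
        by (cases k) (auto simp: ijb split: if_splits)
      then show ?thesis unfolding part_def coeff_sum by (intro sum.cong refl)
    qed
    also have "\<dots> = c l" using S l by simp
    finally show "c l = 0" by simp
  qed
qed

lemma X_quot_flat: "flat X_quot affine3 alpha_quot"
  and X_quot_reduced_fibre: "reduced_fibre X_quot affine3 alpha_quot t"
  by (rule flat_and_reduced_of_fibrewise_basis[OF basis_regular basis_expand];
      (assumption | rule basis_independent); assumption)+

lemma alpha_quot_morphism: "morphism X_quot affine3 alpha_quot"
  unfolding morphism_def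
proof (intro conjI ballI)
  fix h assume "h \<in> regular affine3"
  then have "(\<lambda>p. h (alpha p)) \<in> polynomial_functions coords6"
    by (auto simp: regular_affine3 intro: polynomial_intros)
  moreover have "pullback X_quot alpha_quot h
      = (\<lambda>v. if v \<in> points X_quot then h (alpha (quot_coords v)) else 0)"
    by (auto simp: pullback_def alpha_quot_coords)
  ultimately show "pullback X_quot alpha_quot h \<in> regular X_quot"
    unfolding regular_X_quot by (auto intro: bexI[rotated])
qed (simp add: affine3_def affine_space_def)

section \<open>The central fibre\<close>

lemma regular_D6: "f \<in> regular D6_surface \<longleftrightarrow> (\<exists>g\<in>polynomial_functions coords3.
    f = (\<lambda>p. if p \<in> points D6_surface then g p else 0))"
  by (auto simp: D6_surface_def subvariety_def regular_affine3)

lemma points_D6: "(x, y, z) \<in> points D6_surface \<longleftrightarrow> x ^ 5 + x * y ^ 2 + z ^ 2 = 0"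
  by (simp add: D6_surface_def subvariety_def affine3_def affine_space_def)

text \<open>
  At \<open>t = 0\<close> the cubic is \<open>x\<^sup>3\<close>. Completing the square in \<open>c\<^sup>2 = x a\<^sup>2 - a x\<^sup>3\<close> gives
  \<open>c\<^sup>2 = x (a - x\<^sup>2/2)\<^sup>2 - x\<^sup>5/4\<close>, which is the equation of type \<open>D\<^sub>6\<close> up to scaling.
\<close>

lemma D6_equation: "(2 * c) ^ 2 + x * (2 * \<i> * (a - x ^ 2 / 2)) ^ 2 + x ^ 5
    = 4 * (c ^ 2 - eval2 (branch (0, 0, 0)) x a)"
proof -
  have "(2 * \<i> * (a - x ^ 2 / 2)) ^ 2 = - 4 * (a - x ^ 2 / 2) ^ 2"
    by (simp add: power_mult_distrib)
  then show ?thesis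
    by (simp add: eval2_branch cubic_def power2_diff power_divide field_simps)
      (simp add: eval_nat_numeral algebra_simps)
qed

lemma central_fibre: "isomorphic (fibre X_quot alpha_quot (0, 0, 0)) D6_surface"
proof -
  let ?F = "fibre X_quot alpha_quot (0, 0, 0)"
  define to_D6 :: "C6 \<Rightarrow> C3" where
    "to_D6 p = (fst p, 2 * \<i> * (fst (snd p) - fst p ^ 2 / 2), 2 * fst (snd (snd p)))" for p
  define from_D6 :: "C3 \<Rightarrow> C6" where
    "from_D6 u = (fst u, fst (snd u) / (2 * \<i>) + fst u ^ 2 / 2, snd (snd u) / 2, 0, 0, 0)" for u
  define \<phi> where "\<phi> v = to_D6 (quot_coords v)" for v
  define \<psi> where "\<psi> u = (SOME v. v \<in> points ?F \<and> quot_coords v = from_D6 u)" for u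
  have inv: "to_D6 (from_D6 u) = u" for u
    by (simp add: to_D6_def from_D6_def)
  have co: "\<exists>x a c. quot_coords v = (x, a, c, 0, 0, 0) \<and> c ^ 2 = eval2 (branch (0, 0, 0)) x a"
    if "v \<in> points ?F" for v
  proof -
    obtain x a c t where v: "quot_coords v = (x, a, c, t)" by (cases "quot_coords v") auto
    moreover have "t = (0, 0, 0)"
      using that v by (auto simp: points_fibre alpha_quot_coords alpha_eq)
    ultimately show ?thesis using quot_coords_surface that by (auto simp: points_fibre)
  qed
  have inv': "from_D6 (\<phi> v) = quot_coords v" if "v \<in> points ?F" for v
    using co[OF that] by (auto simp: \<phi>_def to_D6_def from_D6_def)
  have \<phi>: "\<phi> v \<in> points D6_surface" if v: "v \<in> points ?F" for v
  proof -
    obtain x a c where xac: "quot_coords v = (x, a, c, 0, 0, 0)" "c ^ 2 = eval2 (branch (0, 0, 0)) x a"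
      using co[OF v] by blast
    then show ?thesis
      using D6_equation[of c x a] by (simp add: \<phi>_def to_D6_def points_D6 add.commute add.left_commute)
  qed
  have \<psi>: "\<psi> u \<in> points ?F \<and> quot_coords (\<psi> u) = from_D6 u" if u: "u \<in> points D6_surface" for u
    unfolding \<psi>_def
  proof (rule someI_ex)
    obtain x a c where xac: "from_D6 u = (x, a, c, 0, 0, 0)" by (rule that[OF from_D6_def])
    have "u = (x, 2 * \<i> * (a - x ^ 2 / 2), 2 * c)" using inv[of u] by (simp add: xac to_D6_def)
    then have "c ^ 2 = eval2 (branch (0, 0, 0)) x a"
      using u D6_equation[of c x a] by (simp add: points_D6 add.commute add.left_commute)
    then obtain v where "v \<in> points X_quot" "quot_coords v = (x, a, c, 0, 0, 0)"
      using quot_coords_surj by blast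
    then show "\<exists>v. v \<in> points ?F \<and> quot_coords v = from_D6 u"
      by (intro exI[of _ v]) (simp add: points_fibre alpha_quot_coords alpha_eq xac)
  qed
  have "morphism ?F D6_surface \<phi>"
    unfolding morphism_def
  proof (intro conjI ballI \<phi>)
    fix h assume "h \<in> regular D6_surface"
    then obtain g where g: "g \<in> polynomial_functions coords3"
      and h: "h = (\<lambda>p. if p \<in> points D6_surface then g p else 0)" by (auto simp: regular_D6)
    have "(\<lambda>p. g (to_D6 p)) \<in> polynomial_functions coords6"
      unfolding to_D6_def by (rule polynomial_compose3[OF g]) (intro polynomial_intros)+
    moreover have "pullback ?F \<phi> h = (\<lambda>v. if v \<in> points ?F then g (to_D6 (quot_coords v)) else 0)"
      using \<phi> by (auto simp: pullback_def h \<phi>_def fun_eq_iff)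
    ultimately show "pullback ?F \<phi> h \<in> regular ?F"
      unfolding regular_fibre by (rule bexI[of _ "\<lambda>p. g (to_D6 p)", rotated])
  qed
  moreover have "morphism D6_surface ?F \<psi>"
    unfolding morphism_def
  proof (intro conjI ballI)
    fix h assume "h \<in> regular ?F"
    then obtain G where G: "G \<in> polynomial_functions coords6"
      and h: "h = (\<lambda>v. if v \<in> points ?F then G (quot_coords v) else 0)" by (auto simp: regular_fibre)
    have "(\<lambda>u. G (from_D6 u)) \<in> polynomial_functions coords3"
      unfolding from_D6_def by (rule polynomial_compose6[OF G]; (simp only: fst_conv snd_conv)?; intro polynomial_intros)
    moreover have "pullback D6_surface \<psi> h = (\<lambda>u. if u \<in> points D6_surface then G (from_D6 u) else 0)"
      using \<psi> by (auto simp: pullback_def h fun_eq_iff)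
    ultimately show "pullback D6_surface \<psi> h \<in> regular D6_surface"
      unfolding regular_D6 by (rule bexI[of _ "\<lambda>u. G (from_D6 u)", rotated])
  qed (use \<psi> in blast)
  moreover have "\<psi> (\<phi> v) = v" if v: "v \<in> points ?F" for v
    using \<psi>[OF \<phi>[OF v]] v by (intro quot_coords_inj) (auto simp: points_fibre inv'[OF v])
  moreover have "\<phi> (\<psi> u) = u" if "u \<in> points D6_surface" for u
    using \<psi>[OF that] by (simp add: \<phi>_def inv)
  ultimately show ?thesis unfolding isomorphic_def by blast
qed

theorem mainTheorem6:
  shows "deformation_of X_quot affine3 alpha_quot (0, 0, 0) D6_surface
    \<and> (\<forall>t2 t4 t6. singular (fibre X_quot alpha_quot (t2, t4, t6)))"
  by (simp add: deformation_of_def alpha_quot_morphism X_quot_flat X_quot_reduced_fibre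
      central_fibre fibre_singular) (simp add: affine3_def affine_space_def)

end
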